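(* There exists an algorithm for dynamic $\mathsf{LIS}^+$ whose worst-case update time is $O(\log^3 n)$ and whose approximation factor is $O(\log n)$.
   Context: Dynamic $\mathsf{LIS}^+$: an array $a$ of distinct numbers starts empty, and operations arrive one at a time, each of the form "insert$(i,x)$" (insert value $x$ at position $i$, $1\le i\le|a|+1$, shifting later elements right); no deletions occur. After each operation the algorithm reports a value $v$ with $\mathsf{LIS}(a)/\alpha\le v\le \mathsf{LIS}(a)$, where $\mathsf{LIS}(a)$ is the length of a longest strictly increasing subsequence of the current array and $\alpha$ is the approximation factor. The worst-case update time is the maximum time to process one operation, in terms of the current array size $n$. *)

theory Defs
  imports Complex_Main "HOL-Library.Landau_Symbols" "HOL-Library.Sublist"
begin

section \<open>Longest increasing subsequences and insertions\<close>

definition LIS :: "'a::linorder list \<Rightarrow> nat" where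
  "LIS a = Max {length s | s. subseq s a \<and> sorted_wrt (<) s}"

text \<open>Positions are 1-based.\<close>

definition insert_at :: "nat \<Rightarrow> 'a \<Rightarrow> 'a list \<Rightarrow> 'a list" where
  "insert_at i x a = take (i - 1) a @ x # drop (i - 1) a"

definition valid_insert :: "nat \<Rightarrow> 'a \<Rightarrow> 'a list \<Rightarrow> bool" where
  "valid_insert i x a \<longleftrightarrow> 1 \<le> i \<and> i \<le> length a + 1 \<and> x \<notin> set a"


section \<open>A word RAM\<close>

text \<open>
  An algorithm is a finite list of procedures over a random-access heap.  There are two sorts of
  cells: words, which are natural numbers below a bound \<open>W\<close> (machine words of \<open>b\<close> bits if
  \<open>W = 2 ^ b\<close>), and values, which hold array elements.  Values are real numbers that can only be
  copied and compared.  Addresses are words, so an algorithm can only use \<open>W\<close> cells of each sort.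
  Each procedure call has its own registers.  A program text mentions only finitely many
  registers, so a call can be implemented on a machine with a single flat memory, with a
  stack of frames, at constant cost.
\<close>

datatype binop = Plus | Minus | Times | Divide | Modulo

datatype wexp =
    Const nat
  | WReg nat
  | WLoad wexp
  | Op binop wexp wexp

datatype vexp =
    VReg nat
  | VLoad wexp

datatype test =
    WEqual wexp wexp
  | WLess wexp wexp
  | VLess vexp vexp
  | Not test
  | And test test

text \<open>\<open>Call r p ws vs\<close> calls procedure \<open>p\<close> with word arguments \<open>ws\<close> and value arguments \<open>vs\<close>,
  and puts the word it returns into register \<open>r\<close>.\<close>

datatype com =
    Skip
  | SetW nat wexp
  | SetV nat vexp
  | StoreW wexp wexp
  | StoreV wexp vexp
  | Seq com com
  | Cond test com com
  | While test com
  | Call nat nat "wexp list" "vexp list"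

type_synonym program = "com list"

record heap =
  wmem :: "nat \<Rightarrow> nat"
  vmem :: "nat \<Rightarrow> real"

record frame =
  wreg :: "nat \<Rightarrow> nat"
  vreg :: "nat \<Rightarrow> real"

text \<open>\<open>Minus\<close> is truncated subtraction.\<close>

fun bin :: "binop \<Rightarrow> nat \<Rightarrow> nat \<Rightarrow> nat" where
  "bin Plus x y = x + y"
| "bin Minus x y = x - y"
| "bin Times x y = x * y"
| "bin Divide x y = x div y"
| "bin Modulo x y = x mod y"

fun wval :: "frame \<Rightarrow> heap \<Rightarrow> wexp \<Rightarrow> nat" where
  "wval f h (Const n) = n"
| "wval f h (WReg r) = wreg f r"
| "wval f h (WLoad e) = wmem h (wval f h e)"
| "wval f h (Op bo e1 e2) = bin bo (wval f h e1) (wval f h e2)"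

fun vval :: "frame \<Rightarrow> heap \<Rightarrow> vexp \<Rightarrow> real" where
  "vval f h (VReg r) = vreg f r"
| "vval f h (VLoad e) = vmem h (wval f h e)"

fun tval :: "frame \<Rightarrow> heap \<Rightarrow> test \<Rightarrow> bool" where
  "tval f h (WEqual e1 e2) \<longleftrightarrow> wval f h e1 = wval f h e2"
| "tval f h (WLess e1 e2) \<longleftrightarrow> wval f h e1 < wval f h e2"
| "tval f h (VLess e1 e2) \<longleftrightarrow> vval f h e1 < vval f h e2"
| "tval f h (Not t) \<longleftrightarrow> \<not> tval f h t"
| "tval f h (And t1 t2) \<longleftrightarrow> tval f h t1 \<and> tval f h t2"

text \<open>Every intermediate word in the evaluation of an expression is below \<open>W\<close>.  A command in
  which this fails has no execution.\<close>

fun wfits :: "nat \<Rightarrow> frame \<Rightarrow> heap \<Rightarrow> wexp \<Rightarrow> bool" where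
  "wfits W f h (Const n) \<longleftrightarrow> n < W"
| "wfits W f h (WReg r) \<longleftrightarrow> wreg f r < W"
| "wfits W f h (WLoad e) \<longleftrightarrow> wfits W f h e \<and> wmem h (wval f h e) < W"
| "wfits W f h (Op bo e1 e2) \<longleftrightarrow>
     wfits W f h e1 \<and> wfits W f h e2 \<and> bin bo (wval f h e1) (wval f h e2) < W"

fun vfits :: "nat \<Rightarrow> frame \<Rightarrow> heap \<Rightarrow> vexp \<Rightarrow> bool" where
  "vfits W f h (VReg r) \<longleftrightarrow> True"
| "vfits W f h (VLoad e) \<longleftrightarrow> wfits W f h e"

fun tfits :: "nat \<Rightarrow> frame \<Rightarrow> heap \<Rightarrow> test \<Rightarrow> bool" where
  "tfits W f h (WEqual e1 e2) \<longleftrightarrow> wfits W f h e1 \<and> wfits W f h e2"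
| "tfits W f h (WLess e1 e2) \<longleftrightarrow> wfits W f h e1 \<and> wfits W f h e2"
| "tfits W f h (VLess e1 e2) \<longleftrightarrow> vfits W f h e1 \<and> vfits W f h e2"
| "tfits W f h (Not t) \<longleftrightarrow> tfits W f h t"
| "tfits W f h (And t1 t2) \<longleftrightarrow> tfits W f h t1 \<and> tfits W f h t2"

text \<open>Time: one unit for each node of each expression or test evaluated and for each command
  executed, except that \<open>Seq\<close> is free.\<close>

fun wcost :: "wexp \<Rightarrow> nat" where
  "wcost (Const n) = 1"
| "wcost (WReg r) = 1"
| "wcost (WLoad e) = 1 + wcost e"
| "wcost (Op bo e1 e2) = 1 + wcost e1 + wcost e2"

fun vcost :: "vexp \<Rightarrow> nat" where
  "vcost (VReg r) = 1"
| "vcost (VLoad e) = 1 + wcost e"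

fun tcost :: "test \<Rightarrow> nat" where
  "tcost (WEqual e1 e2) = 1 + wcost e1 + wcost e2"
| "tcost (WLess e1 e2) = 1 + wcost e1 + wcost e2"
| "tcost (VLess e1 e2) = 1 + vcost e1 + vcost e2"
| "tcost (Not t) = 1 + tcost t"
| "tcost (And t1 t2) = 1 + tcost t1 + tcost t2"

text \<open>Arguments are passed in the registers \<open>0, 1, \<dots>\<close>; all other registers of a new frame are zero.\<close>

definition args_frame :: "nat list \<Rightarrow> real list \<Rightarrow> frame" where
  "args_frame ws vs = \<lparr>wreg = (\<lambda>r. if r < length ws then ws ! r else 0),
                       vreg = (\<lambda>r. if r < length vs then vs ! r else 0)\<rparr>"

text \<open>\<open>exec W P c f h k f' h'\<close>: started with registers \<open>f\<close> and heap \<open>h\<close>, command \<open>c\<close> terminates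
  after \<open>k\<close> time units with registers \<open>f'\<close> and heap \<open>h'\<close>, all words staying below \<open>W\<close>.
  A procedure returns the contents of its word register \<open>0\<close>.\<close>

inductive exec ::
    "nat \<Rightarrow> program \<Rightarrow> com \<Rightarrow> frame \<Rightarrow> heap \<Rightarrow> nat \<Rightarrow> frame \<Rightarrow> heap \<Rightarrow> bool"
  for W :: nat and P :: program where
  Skip: "exec W P Skip f h 1 f h"
| SetW: "wfits W f h e \<Longrightarrow>
    exec W P (SetW r e) f h (1 + wcost e) (f\<lparr>wreg := (wreg f)(r := wval f h e)\<rparr>) h"
| SetV: "vfits W f h e \<Longrightarrow>
    exec W P (SetV r e) f h (1 + vcost e) (f\<lparr>vreg := (vreg f)(r := vval f h e)\<rparr>) h"
| StoreW: "wfits W f h a \<Longrightarrow> wfits W f h e \<Longrightarrow>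
    exec W P (StoreW a e) f h (1 + wcost a + wcost e)
      f (h\<lparr>wmem := (wmem h)(wval f h a := wval f h e)\<rparr>)"
| StoreV: "wfits W f h a \<Longrightarrow> vfits W f h e \<Longrightarrow>
    exec W P (StoreV a e) f h (1 + wcost a + vcost e)
      f (h\<lparr>vmem := (vmem h)(wval f h a := vval f h e)\<rparr>)"
| Seq: "exec W P c1 f h k1 f1 h1 \<Longrightarrow> exec W P c2 f1 h1 k2 f2 h2 \<Longrightarrow>
    exec W P (Seq c1 c2) f h (k1 + k2) f2 h2"
| CondTrue: "tfits W f h t \<Longrightarrow> tval f h t \<Longrightarrow> exec W P c1 f h k f' h' \<Longrightarrow>
    exec W P (Cond t c1 c2) f h (1 + tcost t + k) f' h'"
| CondFalse: "tfits W f h t \<Longrightarrow> \<not> tval f h t \<Longrightarrow> exec W P c2 f h k f' h' \<Longrightarrow>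
    exec W P (Cond t c1 c2) f h (1 + tcost t + k) f' h'"
| WhileFalse: "tfits W f h t \<Longrightarrow> \<not> tval f h t \<Longrightarrow>
    exec W P (While t c) f h (1 + tcost t) f h"
| WhileTrue: "tfits W f h t \<Longrightarrow> tval f h t \<Longrightarrow> exec W P c f h k1 f1 h1 \<Longrightarrow>
    exec W P (While t c) f1 h1 k2 f2 h2 \<Longrightarrow>
    exec W P (While t c) f h (1 + tcost t + k1 + k2) f2 h2"
| Call: "p < length P \<Longrightarrow> \<forall>e \<in> set ws. wfits W f h e \<Longrightarrow> \<forall>e \<in> set vs. vfits W f h e \<Longrightarrow>
    exec W P (P ! p) (args_frame (map (wval f h) ws) (map (vval f h) vs)) h k f' h' \<Longrightarrow>
    wreg f' 0 < W \<Longrightarrow>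
    exec W P (Call r p ws vs) f h
      (1 + sum_list (map wcost ws) + sum_list (map vcost vs) + k)
      (f\<lparr>wreg := (wreg f)(r := wreg f' 0)\<rparr>) h'"

inductive_cases exec_elims:
  "exec W P Skip f h k f' h'"
  "exec W P (SetW r e) f h k f' h'"
  "exec W P (SetV r e) f h k f' h'"
  "exec W P (StoreW a e) f h k f' h'"
  "exec W P (StoreV a ve) f h k f' h'"
  "exec W P (Seq c1 c2) f h k f' h'"
  "exec W P (Cond t c1 c2) f h k f' h'"
  "exec W P (While t c) f h k f' h'"
  "exec W P (Call r p ws vs) f h k f' h'"

lemma exec_deterministic:
  "exec W P c f h k f' h' \<Longrightarrow> exec W P c f h k2 f2 h2 \<Longrightarrow> k2 = k \<and> f2 = f' \<and> h2 = h'"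
proof (induction arbitrary: k2 f2 h2 rule: exec.induct)
  case (Seq c1 f h k1 f1 h1 c2 k2' f2' h2')
  from Seq.prems obtain l1 g1 j1 l2 where
    "exec W P c1 f h l1 g1 j1" "exec W P c2 g1 j1 l2 f2 h2" "k2 = l1 + l2"
    by (rule exec_elims(6))
  with Seq.IH show ?case by blast
next
  case (CondTrue f h t c1 k f' h' c2)
  from CondTrue.prems obtain l where
    "exec W P c1 f h l f2 h2" "k2 = 1 + tcost t + l"
    by (rule exec_elims(7)) (use CondTrue.hyps(2) in simp_all)
  with CondTrue.IH show ?case by blast
next
  case (CondFalse f h t c2 k f' h' c1)
  from CondFalse.prems obtain l where
    "exec W P c2 f h l f2 h2" "k2 = 1 + tcost t + l"
    by (rule exec_elims(7)) (use CondFalse.hyps(2) in simp_all)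
  with CondFalse.IH show ?case by blast
next
  case (WhileFalse f h t c)
  from WhileFalse.prems show ?case
    by (rule exec_elims(8)) (use WhileFalse.hyps(2) in simp_all)
next
  case (WhileTrue f h t c k1 f1 h1 k2' f2' h2')
  from WhileTrue.prems obtain l1 g1 j1 l2 where
    "exec W P c f h l1 g1 j1" "exec W P (While t c) g1 j1 l2 f2 h2"
    "k2 = 1 + tcost t + l1 + l2"
    by (rule exec_elims(8)) (use WhileTrue.hyps(2) in simp_all)
  with WhileTrue.IH show ?case by blast
next
  case (Call p ws f h vs k f' h' r)
  from Call.prems obtain l g where
    "exec W P (P ! p) (args_frame (map (wval f h) ws) (map (vval f h) vs)) h l g h2"
    "k2 = 1 + sum_list (map wcost ws) + sum_list (map vcost vs) + l"
    "f2 = f\<lparr>wreg := (wreg f)(r := wreg g 0)\<rparr>"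
    by (rule exec_elims(9)) auto
  with Call.IH show ?case by blast
qed (auto elim: exec_elims(1-5))


section \<open>Insertion-only dynamic LIS\<close>

definition empty_heap :: heap where
  "empty_heap = \<lparr>wmem = (\<lambda>_. 0), vmem = (\<lambda>_. 0)\<rparr>"

text \<open>Procedure \<open>0\<close> processes the operation \<open>insert(i, x)\<close>: on heap \<open>h\<close> it reports \<open>v\<close> after
  \<open>k\<close> time units and leaves the heap \<open>h'\<close>.\<close>

definition update :: "nat \<Rightarrow> program \<Rightarrow> nat \<Rightarrow> real \<Rightarrow> heap \<Rightarrow> nat \<Rightarrow> nat \<Rightarrow> heap \<Rightarrow> bool" where
  "update W P i x h k v h' \<longleftrightarrow>
     P \<noteq> [] \<and> i < W \<and> v < W \<and>
     (\<exists>f'. exec W P (P ! 0) (args_frame [i] [x]) h k f' h' \<and> v = wreg f' 0)"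

text \<open>The pairs of an array and a heap that occur when a sequence of insertions is processed from
  the empty array and the zero heap.  The word length available for the operation that makes the
  array have size \<open>n\<close> is \<open>b n\<close> bits.\<close>

inductive reachable :: "(nat \<Rightarrow> nat) \<Rightarrow> program \<Rightarrow> real list \<Rightarrow> heap \<Rightarrow> bool"
  for b :: "nat \<Rightarrow> nat" and P :: program where
  empty: "reachable b P [] empty_heap"
| insertion: "reachable b P a h \<Longrightarrow> valid_insert i x a \<Longrightarrow>
    update (2 ^ b (length a + 1)) P i x h k v h' \<Longrightarrow> reachable b P (insert_at i x a) h'"

text \<open>Since execution is deterministic, the values \<open>k\<close>, \<open>v\<close>, \<open>h'\<close> below are unique.\<close>

definition solves_dynamic_LIS_plus ::
    "(nat \<Rightarrow> nat) \<Rightarrow> program \<Rightarrow> (nat \<Rightarrow> real) \<Rightarrow> (nat \<Rightarrow> real) \<Rightarrow> bool" where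
  "solves_dynamic_LIS_plus b P T \<alpha> \<longleftrightarrow>
     (\<forall>n. 1 \<le> \<alpha> n) \<and>
     (\<forall>a h i x. reachable b P a h \<longrightarrow> valid_insert i x a \<longrightarrow>
        (let a' = insert_at i x a; n = length a' in
           \<exists>k v h'. update (2 ^ b n) P i x h k v h' \<and>
             real k \<le> T n \<and>
             real (LIS a') / \<alpha> n \<le> real v \<and> v \<le> LIS a'))"

end

theory Submission
  imports Defs "HOL-Library.Log_Nat"
begin

text \<open>
  LIS is subadditive: if the insertions are split into \<open>m\<close> blocks of consecutive insertions, some block
  contains an increasing subsequence of length at least \<open>LIS / m\<close>.  As in the logarithmic method of
  Bentley and Saxe, blocks are aligned intervals of \<open>2 ^ k\<close> insertions, and a block is obtained by merging
  its two halves, each stored as a list of values with positions sorted by position.  The positions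
  refer to the array at the end of the block, so this merge needs no order-maintenance structure.
  While it is merged, a block is also fed into patience sorting, which gives its LIS, and the
  algorithm reports the largest LIS seen.

  To make the running time worst case, insertion \<open>t\<close> produces, on every level \<open>k \<ge> 1\<close> with
  \<open>2 * 2 ^ k \<le> t\<close>, the single entry \<open>t - 2 * 2 ^ k\<close>.  The delay \<open>2 * 2 ^ k\<close> guarantees that both halves are
  complete when the merge of a block starts.  At any time fewer than six complete blocks per level
  cover all insertions.
\<close>

section \<open>Longest increasing subsequences and patience sorting\<close>

lemma LIS_finite: "finite {length s | s. subseq s a \<and> sorted_wrt (<) s}"
proof (rule finite_subset)
  show "{length s | s. subseq s a \<and> sorted_wrt (<) s} \<subseteq> {..length a}"
    by (auto dest: list_emb_length)
qed simp

lemma LIS_ge: "subseq s a \<Longrightarrow> sorted_wrt (<) s \<Longrightarrow> length s \<le> LIS a"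
  unfolding LIS_def by (rule Max_ge[OF LIS_finite]) auto

lemma LIS_attained: "\<exists>s. subseq s a \<and> sorted_wrt (<) s \<and> length s = LIS a"
proof -
  have "LIS a \<in> {length s | s. subseq s a \<and> sorted_wrt (<) s}"
    unfolding LIS_def by (rule Max_in[OF LIS_finite]) (auto intro: exI[of _ "[]"])
  then show ?thesis by auto
qed

lemma LIS_mono: "subseq a b \<Longrightarrow> LIS a \<le> LIS b"
  using LIS_attained[of a] LIS_ge subseq_order.order_trans by metis

lemma LIS_Nil [simp]: "LIS [] = 0"
  using LIS_attained[of "[]"] by (auto dest: list_emb_Nil2)

lemma LIS_singleton [simp]: "LIS [x] = 1"
proof (rule antisym)
  show "LIS [x] \<le> 1"
    using LIS_attained[of "[x]"] by (auto dest: list_emb_length)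
  show "1 \<le> LIS [x]"
    using LIS_ge[of "[x]" "[x]"] by simp
qed

text \<open>\<open>T ! m\<close> is the least last element of an increasing subsequence of length \<open>m + 1\<close>, as in
  patience sorting.\<close>

definition tails :: "'a::linorder list \<Rightarrow> 'a list \<Rightarrow> bool" where
  "tails xs T \<longleftrightarrow> sorted_wrt (<) T \<and>
     (\<forall>m < length T. \<exists>s. subseq s xs \<and> sorted_wrt (<) s \<and> length s = Suc m \<and> last s = T ! m) \<and>
     (\<forall>s. subseq s xs \<longrightarrow> sorted_wrt (<) s \<longrightarrow> s \<noteq> [] \<longrightarrow>
        length s \<le> length T \<and> T ! (length s - 1) \<le> last s)"

lemma tails_Nil: "tails [] []"
  by (simp add: tails_def)

lemma tails_length: "tails xs T \<Longrightarrow> length T = LIS xs"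
proof (rule antisym)
  assume T: "tails xs T"
  show "length T \<le> LIS xs"
  proof (cases T rule: rev_cases)
    case (snoc T' y)
    then have "\<exists>s. subseq s xs \<and> sorted_wrt (<) s \<and> length s = length T"
      using T by (force simp: tails_def)
    then show ?thesis using LIS_ge by metis
  qed simp
  obtain s where "subseq s xs" "sorted_wrt (<) s" "length s = LIS xs"
    using LIS_attained by blast
  with T show "LIS xs \<le> length T"
    by (cases "s = []") (auto simp: tails_def)
qed

text \<open>A new increasing subsequence ends in \<open>x\<close>, and by \<open>hi\<close> at most
  \<open>l\<close> elements precede it, so only the minimum for length \<open>Suc l\<close> can
  change. \<open>T'\<close> is given pointwise because the program overwrites a single cell:
  \<open>l = length T\<close> adds a tail, a smaller \<open>l\<close> replaces one.\<close>

lemma tails_snoc: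
  assumes T: "tails xs T" and l: "l \<le> length T"
    and lo: "\<And>m. m < l \<Longrightarrow> T ! m < x" and hi: "\<And>m. l \<le> m \<Longrightarrow> m < length T \<Longrightarrow> x \<le> T ! m"
    and len: "length T' = max (Suc l) (length T)"
    and nth: "\<And>m. m < length T' \<Longrightarrow> T' ! m = (if m = l then x else T ! m)"
  shows "tails (xs @ [x]) T'"
proof -
  have sT: "T ! i < T ! j" if "i < j" "j < length T" for i j
    using T that by (auto simp: tails_def sorted_wrt_iff_nth_less)
  have 1: "sorted_wrt (<) T'"
    unfolding sorted_wrt_iff_nth_less
  proof (intro allI impI)
    fix i j assume ij: "i < j" "j < length T'"
    have "j < length T" if "j \<noteq> l"
      using ij len l that by linarith
    then consider "j = l" | "i = l" "j < length T" | "i \<noteq> l" "j \<noteq> l" "j < length T"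
      by blast
    then show "T' ! i < T' ! j"
    proof cases
      case 1 then show ?thesis using ij lo nth by auto
    next
      case 2
      have "x \<le> T ! l" using 2 ij hi[of l] by auto
      also have "\<dots> < T ! j" using 2 ij sT by auto
      finally show ?thesis using 2 ij nth by auto
    next
      case 3 then show ?thesis using ij nth sT by auto
    qed
  qed
  have 2: "\<exists>s. subseq s (xs @ [x]) \<and> sorted_wrt (<) s \<and> length s = Suc m \<and> last s = T' ! m"
    if m: "m < length T'" for m
  proof (cases "m = l")
    case False
    with m len l have "m < length T" by linarith
    then obtain s where "subseq s xs" "sorted_wrt (<) s" "length s = Suc m" "last s = T ! m"
      using T by (auto simp: tails_def)
    with False show ?thesis using nth[OF m]
      by (intro exI[of _ s]) auto
  next
    case True
    show ?thesis
    proof (cases l)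
      case 0
      then show ?thesis using True nth[OF m]
        by (intro exI[of _ "[x]"]) (simp add: subseq_singleton_left)
    next
      case (Suc l')
      then have "l' < length T" using l by simp
      then obtain s where s: "subseq s xs" "sorted_wrt (<) s" "length s = Suc l'" "last s = T ! l'"
        using T unfolding tails_def by blast
      have "y < x" if "y \<in> set s" for y
      proof -
        have "y \<le> last s" using that s(2)
          by (induction s rule: rev_induct) (auto simp: sorted_wrt_append less_imp_le)
        with s lo[of l'] Suc show ?thesis by auto
      qed
      then show ?thesis using s True Suc nth[OF m]
        by (intro exI[of _ "s @ [x]"]) (simp add: sorted_wrt_append)
    qed
  qed
  have 3: "length s \<le> length T' \<and> T' ! (length s - 1) \<le> last s"
    if s: "subseq s (xs @ [x])" "sorted_wrt (<) s" "s \<noteq> []" for s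
  proof -
    from s(1) obtain s1 s2 where s12: "s = s1 @ s2" "subseq s1 xs" "subseq s2 [x]"
      by (elim subseq_appendE) auto
    have "s2 = [] \<or> s2 = [x]"
      using s12(3) by (cases s2) (auto dest: list_emb_length split: if_splits)
    then show ?thesis
    proof
      assume "s2 = []"
      with s12 s T have *: "length s \<le> length T" "T ! (length s - 1) \<le> last s"
        by (auto simp: tails_def)
      have "length s - 1 < length T" using s(3) * by (cases s) auto
      then have "T' ! (length s - 1) \<le> T ! (length s - 1)"
        using nth[of "length s - 1"] hi[of l] len by (cases "length s - 1 = l") auto
      with * len show ?thesis by auto
    next
      assume s2: "s2 = [x]"
      have "length s1 \<le> l"
      proof (cases "s1 = []")
        case False
        then have *: "length s1 \<le> length T" "T ! (length s1 - 1) \<le> last s1"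
          using s12 s T s2 by (auto simp: tails_def sorted_wrt_append)
        have "last s1 < x" using s s12 s2 False by (auto simp: sorted_wrt_append)
        with * have "T ! (length s1 - 1) < x" by auto
        with hi[of "length s1 - 1"] * False have "\<not> l \<le> length s1 - 1"
          by (metis Suc_pred' length_greater_0_conv less_eq_Suc_le not_le)
        then show ?thesis by linarith
      qed simp
      then have "T' ! length s1 \<le> x"
        using nth[of "length s1"] lo[of "length s1"] len by (cases "length s1 = l") auto
      with \<open>length s1 \<le> l\<close> s12 s2 len show ?thesis by auto
    qed
  qed
  show ?thesis unfolding tails_def using 1 2 3 by blast
qed

section \<open>Merging recorded insertions\<close>

text \<open>\<open>inserted d xs a a'\<close>: inserting the values in \<open>xs\<close> into \<open>a\<close> gives \<open>a'\<close>, where \<open>xs\<close> lists them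
  with their positions in \<open>a'\<close>, shifted by \<open>d\<close>.\<close>

inductive inserted :: "nat \<Rightarrow> (nat \<times> 'a) list \<Rightarrow> 'a list \<Rightarrow> 'a list \<Rightarrow> bool" where
  Nil: "inserted d [] [] []"
| New: "inserted (Suc d) xs a a' \<Longrightarrow> inserted d ((Suc d, v) # xs) a (v # a')"
| Old: "inserted (Suc d) xs a a' \<Longrightarrow> inserted d xs (v # a) (v # a')"

lemma inserted_refl: "inserted d [] a a"
  by (induction a arbitrary: d) (auto intro: inserted.intros)

lemma inserted_single:
  "i \<le> length a \<Longrightarrow> inserted d [(Suc (d + i), x)] a (take i a @ x # drop i a)"
proof (induction i arbitrary: a d)
  case 0
  then show ?case using inserted.New[OF inserted_refl] by auto
next
  case (Suc i)
  then obtain y b where "a = y # b" by (cases a) auto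
  with Suc.IH[of b "Suc d"] Suc.prems show ?case by (auto intro: inserted.Old)
qed

text \<open>These bounds decide the comparison in \<open>inserted_merge\<close> and later keep
  stored positions within a machine word.\<close>

lemma inserted_pos:
  "inserted d xs a a' \<Longrightarrow> pv \<in> set xs \<Longrightarrow> d < fst pv \<and> fst pv \<le> d + length a'"
  by (induction rule: inserted.induct) force+

lemma inserted_subseq: "inserted d xs a a' \<Longrightarrow> subseq (map snd xs) a'"
  by (induction rule: inserted.induct) auto

text \<open>Subadditivity: an increasing subsequence of \<open>a'\<close> splits into its old and
  its new elements. The clause on sets carries the induction: a head below the rest of
  \<open>s\<close> is below all elements of both parts.\<close>

lemma inserted_LIS_le:
  assumes "inserted d xs a a'"
  shows "LIS a' \<le> LIS a + LIS (map snd xs)"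
proof -
  have split: "\<exists>u v. subseq u a \<and> subseq v (map snd xs) \<and> sorted_wrt (<) u \<and> sorted_wrt (<) v
      \<and> length s = length u + length v \<and> set s = set u \<union> set v"
    if "subseq s a'" "sorted_wrt (<) s" for s
    using assms that
  proof (induction arbitrary: s rule: inserted.induct)
    case (Nil d)
    then show ?case by auto
  next
    case (New d xs a a' v)
    show ?case
    proof (cases "subseq s a'")
      case True
      then show ?thesis using New.IH[of s] New.prems by (metis list.simps(9) list_emb_Cons)
    next
      case False
      then obtain s' where s: "s = v # s'" "subseq s' a'"
        using New.prems by (cases s) (auto split: if_splits simp: subseq_Cons')
      with New.IH[of s'] New.prems obtain u w where uw: "subseq u a" "subseq w (map snd xs)"
         "sorted_wrt (<) u" "sorted_wrt (<) w" "length s' = length u + length w" "set s' = set u \<union> set w"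
        by auto
      show ?thesis
        using uw s New.prems by (intro exI[of _ u] exI[of _ "v # w"]) auto
    qed
  next
    case (Old d xs a a' v)
    show ?case
    proof (cases "subseq s a'")
      case True
      then show ?thesis using Old.IH[of s] Old.prems by (metis list_emb_Cons)
    next
      case False
      then obtain s' where s: "s = v # s'" "subseq s' a'"
        using Old.prems by (cases s) (auto split: if_splits simp: subseq_Cons')
      with Old.IH[of s'] Old.prems obtain u w where uw: "subseq u a" "subseq w (map snd xs)"
         "sorted_wrt (<) u" "sorted_wrt (<) w" "length s' = length u + length w" "set s' = set u \<union> set w"
        by auto
      show ?thesis
        using uw s Old.prems by (intro exI[of _ "v # u"] exI[of _ w]) auto
    qed
  qed
  obtain s where "subseq s a'" "sorted_wrt (<) s" "length s = LIS a'"
    using LIS_attained by blast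
  with split[of s] show ?thesis
    by (metis LIS_ge add_mono)
qed

text \<open>\<open>ys\<close> was inserted after \<open>xs\<close>, so an element of \<open>xs\<close> has moved right by the number \<open>c\<close> of elements
  of \<open>ys\<close> to its left, which are exactly those already output.\<close>

fun merge :: "nat \<Rightarrow> (nat \<times> 'a) list \<Rightarrow> (nat \<times> 'a) list \<Rightarrow> (nat \<times> 'a) list" where
  "merge c [] ys = ys"
| "merge c ((p, v) # xs) [] = (p + c, v) # merge c xs []"
| "merge c ((p, v) # xs) ((q, w) # ys) =
     (if p + c < q then (p + c, v) # merge c xs ((q, w) # ys)
      else (q, w) # merge (Suc c) ((p, v) # xs) ys)"

lemma length_merge [simp]: "length (merge c xs ys) = length xs + length ys"
  by (induction c xs ys rule: merge.induct) auto

text \<open>The recursion of \<open>merge\<close> in terms of two cursors, which is what the program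
  keeps. An exhausted list is never chosen.\<close>

lemma merge_step:
  assumes "u < length xs \<or> w < length ys"
  shows "merge c (drop u xs) (drop w ys) =
    (if w < length ys \<and> \<not> (u < length xs \<and> fst (xs ! u) + c < fst (ys ! w))
     then ys ! w # merge (Suc c) (drop u xs) (drop (Suc w) ys)
     else (fst (xs ! u) + c, snd (xs ! u)) # merge c (drop (Suc u) xs) (drop w ys))"
proof -
  obtain p v q z where pv: "xs ! u = (p, v)" and qz: "ys ! w = (q, z)" by fastforce
  have u: "drop u xs = (if u < length xs then (p, v) # drop (Suc u) xs else [])"
    by (simp add: Cons_nth_drop_Suc flip: pv)
  have w: "drop w ys = (if w < length ys then (q, z) # drop (Suc w) ys else [])"
    by (simp add: Cons_nth_drop_Suc flip: qz)
  show ?thesis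
    using assms unfolding u w pv qz
    by (cases "u < length xs"; cases "w < length ys") (simp_all del: drop_eq_Nil)
qed

text \<open>Induction along the final array, with \<open>d\<close> elements of \<open>a'\<close> and
  \<open>d + c\<close> elements of \<open>a''\<close> already passed. If the next element is new, it
  heads one of the lists, and \<open>inserted_pos\<close> makes the test of \<open>merge\<close>
  choose that list. Ties go to \<open>ys\<close>, whose element pushes the other one right.\<close>

lemma inserted_merge:
  "inserted (d + c) ys a' a'' \<Longrightarrow> inserted d xs a a' \<Longrightarrow> inserted (d + c) (merge c xs ys) a a''"
proof (induction a'' arbitrary: d c xs ys a a')
  case Nil
  from Nil.prems(1) have "ys = []" "a' = []" by (auto elim: inserted.cases)
  with Nil.prems(2) have "xs = []" "a = []" by (auto elim: inserted.cases)
  with \<open>ys = []\<close> show ?case by (auto intro: inserted.intros)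
next
  case (Cons z a'')
  from Cons.prems(1) show ?case
  proof (cases rule: inserted.cases)
    case (New ys')
    have "merge c xs ys = (Suc (d + c), z) # merge (Suc c) xs ys'"
    proof (cases xs)
      case (Cons pv xs')
      with Cons.prems(2) inserted_pos[of d xs a a' pv] New show ?thesis
        by (cases pv) auto
    qed (simp add: New)
    moreover have "inserted (Suc (d + c)) (merge (Suc c) xs ys') a a''"
      using Cons.IH[of d "Suc c" ys' a' xs a] New Cons.prems by simp
    ultimately show ?thesis by (auto intro: inserted.New)
  next
    case (Old b')
    from Cons.prems(2)[unfolded Old] show ?thesis
    proof (cases rule: inserted.cases)
      case (New xs')
      have "merge c xs ys = (Suc (d + c), z) # merge c xs' ys"
      proof (cases ys)
        case (Cons qw ys')
        with Old inserted_pos[of "Suc (d + c)" ys b' a'' qw] New show ?thesis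
          by (cases qw) auto
      qed (simp add: New)
      moreover have "inserted (Suc (d + c)) (merge c xs' ys) a a''"
        using Cons.IH[of "Suc d" c ys b' xs' a] New Old by simp
      ultimately show ?thesis by (auto intro: inserted.New)
    next
      case (Old b)
      then show ?thesis
        using Cons.IH[of "Suc d" c ys b' xs b] \<open>inserted (Suc (d + c)) ys b' a''\<close>
        by (auto intro: inserted.Old)
    qed
  qed
qed

section \<open>Weakest preconditions with running time\<close>

text \<open>Total correctness with elapsed time. An overflowing command has no execution, so a
  \<open>wp\<close> statement also asserts that every word stays below \<open>W\<close>.\<close>

definition wp :: "nat \<Rightarrow> program \<Rightarrow> com \<Rightarrow> (nat \<Rightarrow> frame \<Rightarrow> heap \<Rightarrow> bool) \<Rightarrow> frame \<Rightarrow> heap \<Rightarrow> bool" where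
  "wp W P c Q f h \<longleftrightarrow> (\<exists>k f' h'. exec W P c f h k f' h' \<and> Q k f' h')"

lemma wp_simps:
  "wp W P Skip Q f h \<longleftrightarrow> Q 1 f h"
  "wp W P (SetW r e) Q f h \<longleftrightarrow>
     wfits W f h e \<and> Q (1 + wcost e) (f\<lparr>wreg := (wreg f)(r := wval f h e)\<rparr>) h"
  "wp W P (SetV r ve) Q f h \<longleftrightarrow>
     vfits W f h ve \<and> Q (1 + vcost ve) (f\<lparr>vreg := (vreg f)(r := vval f h ve)\<rparr>) h"
  "wp W P (StoreW a e) Q f h \<longleftrightarrow>
     wfits W f h a \<and> wfits W f h e \<and>
     Q (1 + wcost a + wcost e) f (h\<lparr>wmem := (wmem h)(wval f h a := wval f h e)\<rparr>)"
  "wp W P (StoreV a ve) Q f h \<longleftrightarrow>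
     wfits W f h a \<and> vfits W f h ve \<and>
     Q (1 + wcost a + vcost ve) f (h\<lparr>vmem := (vmem h)(wval f h a := vval f h ve)\<rparr>)"
  "wp W P (Seq c1 c2) Q f h \<longleftrightarrow> wp W P c1 (\<lambda>k. wp W P c2 (\<lambda>k'. Q (k + k'))) f h"
  unfolding wp_def
  by (fastforce elim: exec_elims intro: exec.intros)+

lemma wp_Cond:
  "wp W P (Cond t c1 c2) Q f h \<longleftrightarrow>
     tfits W f h t \<and>
     (if tval f h t then wp W P c1 (\<lambda>k. Q (1 + tcost t + k)) f h
      else wp W P c2 (\<lambda>k. Q (1 + tcost t + k)) f h)"
proof (cases "tval f h t")
  case True
  then show ?thesis unfolding wp_def
    by (fastforce elim: exec_elims(7) intro: exec.CondTrue)
next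
  case False
  then show ?thesis unfolding wp_def
    by (fastforce elim: exec_elims(7) intro: exec.CondFalse)
qed

lemma wp_While_exit:
  assumes "tfits W f h t" "\<not> tval f h t" "Q (1 + tcost t) f h"
  shows "wp W P (While t c) Q f h"
  unfolding wp_def using exec.WhileFalse[OF assms(1,2)] assms(3) by blast

lemma wp_mono:
  "wp W P c Q f h \<Longrightarrow> (\<And>k f' h'. Q k f' h' \<Longrightarrow> Q' k f' h') \<Longrightarrow> wp W P c Q' f h"
  unfolding wp_def by blast

text \<open>The index \<open>m\<close> of the invariant is a budget of remaining iterations, so it
  proves termination and bounds time at once. The 1 in \<open>m + 1\<close> pays for the last,
  failing test.\<close>

lemma wp_While:
  assumes "I m f h"
    and fits: "\<And>m f h. I m f h \<Longrightarrow> tfits W f h t"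
    and step: "\<And>m f h. I m f h \<Longrightarrow> tval f h t \<Longrightarrow>
      0 < m \<and> wp W P c (\<lambda>k f' h'. k \<le> B \<and> I (m - 1) f' h') f h"
  shows "wp W P (While t c)
    (\<lambda>k f' h'. k \<le> (m + 1) * (1 + tcost t + B) \<and> \<not> tval f' h' t \<and> (\<exists>m' \<le> m. I m' f' h')) f h"
  using assms(1)
proof (induction m arbitrary: f h)
  case 0
  then have "\<not> tval f h t" using step by blast
  with 0 fits show ?case by (intro wp_While_exit) auto
next
  case (Suc m)
  show ?case
  proof (cases "tval f h t")
    case False
    with Suc.prems fits show ?thesis by (intro wp_While_exit) auto
  next
    case True
    with step[OF Suc.prems] obtain k1 f1 h1 where
      1: "exec W P c f h k1 f1 h1" "k1 \<le> B" "I m f1 h1"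
      by (auto simp: wp_def)
    from Suc.IH[OF 1(3)] obtain k2 f2 h2 where
      2: "exec W P (While t c) f1 h1 k2 f2 h2" "k2 \<le> (m + 1) * (1 + tcost t + B)"
         "\<not> tval f2 h2 t" "\<exists>m' \<le> m. I m' f2 h2"
      by (auto simp: wp_def)
    have "exec W P (While t c) f h (1 + tcost t + k1 + k2) f2 h2"
      using exec.WhileTrue[OF fits[OF Suc.prems] True 1(1) 2(1)] .
    moreover have "1 + tcost t + k1 + k2 \<le> (Suc m + 1) * (1 + tcost t + B)"
      using 1(2) 2(2) by simp
    ultimately show ?thesis unfolding wp_def using 2(3,4) le_SucI by blast
  qed
qed

section \<open>The procedure\<close>

text \<open>
  Level \<open>k\<close> consists of the blocks of \<open>2 ^ k\<close> insertions.  Address \<open>adr tag k s\<close> holds, in word memory,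
  the position of the \<open>s\<close>-th entry of level \<open>k\<close> (\<open>tag = 0\<close>) and, for \<open>s = 0\<close>, the number of entries
  taken from the second half of the block under construction (\<open>tag = 1\<close>) and the length of its
  \<open>tails\<close> list (\<open>tag = 2\<close>); in value memory, the value of that entry (\<open>tag = 0\<close>) and the \<open>s\<close>-th tail
  (\<open>tag = 1\<close>).  Word \<open>0\<close> is the number of insertions and word \<open>1\<close> the largest \<open>tails\<close> length so far.
\<close>

definition adr :: "nat \<Rightarrow> nat \<Rightarrow> nat \<Rightarrow> nat" where
  "adr tag k s = 4 * (2 ^ k * (2 * s + 1)) + tag"

text \<open>Every positive integer is uniquely a power of two times an odd number, and the tag is
  the residue modulo 4. Thus levels need no preallocated regions, and an address is computed from
  \<open>2 ^ k\<close> in constant time.\<close>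

lemma adr_inj:
  assumes "adr i k s = adr i' k' s'" "i < 4" "i' < 4"
  shows "i = i' \<and> k = k' \<and> s = s'"
proof -
  have "adr i k s mod 4 = i" "adr i' k' s' mod 4 = i'"
    using assms(2,3) unfolding adr_def by (simp_all only: mod_mult_self4 mod_less)
  then have i: "i = i'" using assms(1) by simp
  with assms(1) have eq: "2 ^ k * (2 * s + 1) = (2::nat) ^ k' * (2 * s' + 1)"
    by (simp add: adr_def)
  have "k \<le> k'" if eq: "2 ^ k * (2 * s + 1) = (2::nat) ^ k' * (2 * s' + 1)" for k k' s s'
  proof (rule ccontr)
    assume "\<not> k \<le> k'"
    then obtain d where "k = k' + Suc d" using less_imp_Suc_add by (metis add_Suc_right not_le)
    then have "2 ^ k * (2 * s + 1) = (2::nat) ^ k' * (2 * (2 ^ d * (2 * s + 1)))"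
      by (simp only: power_add power_Suc mult.assoc mult.left_commute)
    with eq have "(2::nat) ^ k' * (2 * (2 ^ d * (2 * s + 1))) = 2 ^ k' * (2 * s' + 1)" by (simp only:)
    then have "2 * (2 ^ d * (2 * s + 1)) = 2 * s' + 1"
      by (simp only: mult_cancel1) simp
    then show False by presburger
  qed
  from this[OF eq] this[OF eq[symmetric]] have "k = k'" by simp
  with eq i show ?thesis by simp
qed

lemma adr_eq_iff: "i < 4 \<Longrightarrow> i' < 4 \<Longrightarrow> adr i k s = adr i' k' s' \<longleftrightarrow> i = i' \<and> k = k' \<and> s = s'"
  using adr_inj by blast

text \<open>Leaves cells 0 and 1 to the two global counters.\<close>

lemma adr_ge: "4 \<le> adr i k s"
proof -
  have "(1::nat) \<le> 2 ^ k * (2 * s + 1)" by (simp add: Suc_le_eq)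
  then show ?thesis unfolding adr_def by linarith
qed

lemma adr_neq [simp]: "adr i k s \<noteq> 0" "adr i k s \<noteq> Suc 0" "adr i k s \<noteq> 1" "0 \<noteq> adr i k s" "Suc 0 \<noteq> adr i k s" "1 \<noteq> adr i k s"
  using adr_ge[of i k s] by auto

definition cell :: "nat \<Rightarrow> wexp \<Rightarrow> wexp \<Rightarrow> wexp" where
  "cell tag p s = Op Plus (Op Times (Const 4)
     (Op Times p (Op Plus (Op Times (Const 2) s) (Const 1)))) (Const tag)"

lemma wval_cell: "wval f h p = 2 ^ k \<Longrightarrow> wval f h (cell i p s) = adr i k (wval f h s)"
  by (simp add: cell_def adr_def)

lemma wcost_cell [simp]: "wcost (cell i p s) = 9 + wcost p + wcost s"
  by (simp add: cell_def)

text \<open>Quadratic because an address multiplies a block length by an index, both at most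
  \<open>n + 1\<close>. This only doubles the word length, up to a constant.\<close>

definition room :: "nat \<Rightarrow> nat \<Rightarrow> bool" where
  "room W n \<longleftrightarrow> 16 * (n + 2) ^ 2 \<le> W"

lemma room_less:
  assumes "room W n" "x \<le> 4 * n + 6" shows "x < W"
proof -
  have "4 * n + 6 < 16 * (n + 2) ^ 2" by (simp add: power2_eq_square)
  with assms show ?thesis by (simp add: room_def)
qed

lemma wfits_cell:
  assumes "wfits W f h p" "wfits W f h s" "wval f h p \<le> n + 1" "wval f h s \<le> n + 1" "i < 4" "room W n"
  shows "wfits W f h (cell i p s)"
proof -
  let ?P = "wval f h p" and ?S = "wval f h s"
  have 1: "?P * (2 * ?S + 1) \<le> (n + 1) * (2 * (n + 1) + 1)"
    using assms by (intro mult_le_mono) auto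
  have "4 * (?P * (2 * ?S + 1)) + 4 \<le> 4 * ((n + 1) * (2 * (n + 1) + 1)) + 4"
    using 1 by linarith
  also have "\<dots> < 16 * (n + 2) ^ 2"
    by (simp add: power2_eq_square algebra_simps)
  also have "\<dots> \<le> W" using assms by (simp add: room_def)
  finally have *: "4 * (?P * (2 * ?S + 1)) + 4 < W" .
  have "?S \<le> n + 1" using assms by simp
  then have "2 * ?S + 1 < W" using room_less[OF assms(6), of "2 * ?S + 1"] by linarith
  then show ?thesis using assms * by (simp add: cell_def del: mult_Suc_right)
qed

text \<open>
  Word registers: 0 argument and result, 1 time \<open>t\<close>, 2 \<open>p = 2 ^ k\<close>, 3 output index \<open>s = t - 2 * p\<close>, 4 \<open>s mod p\<close>,
  5 entries taken from the second half, 6 number of tails, 7--9 bounds and midpoint of the binary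
  search, 10 \<open>p div 2\<close>, 11 and 12 indices of the next entries of the first and second half.
\<close>

definition prepare :: com where
  "prepare = Seq (SetW 3 (Op Minus (WReg 1) (Op Times (Const 2) (WReg 2))))
    (Seq (SetW 4 (Op Modulo (WReg 3) (WReg 2)))
    (Seq (SetW 10 (Op Divide (WReg 2) (Const 2)))
    (Seq (Cond (WEqual (WReg 4) (Const 0))
            (Seq (SetW 5 (Const 0)) (SetW 6 (Const 0)))
            (Seq (SetW 5 (WLoad (cell 1 (WReg 2) (Const 0))))
                 (SetW 6 (WLoad (cell 2 (WReg 2) (Const 0))))))
    (Seq (SetW 11 (Op Minus (WReg 3) (WReg 5)))
         (SetW 12 (Op Plus (Op Plus (Op Minus (WReg 3) (WReg 4)) (WReg 10)) (WReg 5)))))))"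

text \<open>\<open>tfits\<close> and \<open>tcost\<close> do not short-circuit \<open>And\<close>,
  so both cells are read even if a half is exhausted. The cursor then points to the first entry
  behind that half, whose address still fits.\<close>

definition second_first :: test where
  "second_first = And (WLess (WReg 5) (WReg 10))
     (Not (And (WLess (Op Minus (WReg 4) (WReg 5)) (WReg 10))
       (WLess (Op Plus (WLoad (cell 0 (WReg 10) (WReg 11))) (WReg 5))
              (WLoad (cell 0 (WReg 10) (WReg 12))))))"

definition emit :: com where
  "emit = Seq
    (Cond second_first
      (Seq (SetW 0 (WLoad (cell 0 (WReg 10) (WReg 12))))
      (Seq (SetV 0 (VLoad (cell 0 (WReg 10) (WReg 12))))
           (SetW 5 (Op Plus (WReg 5) (Const 1)))))
      (Seq (SetW 0 (Op Plus (WLoad (cell 0 (WReg 10) (WReg 11))) (WReg 5)))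
           (SetV 0 (VLoad (cell 0 (WReg 10) (WReg 11))))))
    (Seq (StoreW (cell 0 (WReg 2) (WReg 3)) (WReg 0))
    (Seq (StoreV (cell 0 (WReg 2) (WReg 3)) (VReg 0))
    (Seq (StoreW (cell 1 (WReg 2) (Const 0)) (WReg 5))
    (Seq (SetW 7 (Const 0)) (SetW 8 (WReg 6))))))"

definition search :: com where
  "search = While (WLess (WReg 7) (WReg 8))
    (Seq (SetW 9 (Op Divide (Op Plus (WReg 7) (WReg 8)) (Const 2)))
      (Cond (VLess (VLoad (cell 1 (WReg 2) (WReg 9))) (VReg 0))
        (SetW 7 (Op Plus (WReg 9) (Const 1)))
        (SetW 8 (WReg 9))))"

definition record_tail :: com where
  "record_tail = Seq (StoreV (cell 1 (WReg 2) (WReg 7)) (VReg 0))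
    (Seq (Cond (WEqual (WReg 7) (WReg 6)) (SetW 6 (Op Plus (WReg 6) (Const 1))) Skip)
    (Seq (StoreW (cell 2 (WReg 2) (Const 0)) (WReg 6))
    (Seq (Cond (WLess (WLoad (Const 1)) (WReg 6)) (StoreW (Const 1) (WReg 6)) Skip)
         (SetW 2 (Op Times (Const 2) (WReg 2))))))"

definition level_step :: com where
  "level_step = Seq prepare (Seq emit (Seq search record_tail))"

definition place :: com where
  "place =
    Seq (SetW 1 (WLoad (Const 0)))
    (Seq (StoreW (cell 0 (Const 1) (WReg 1)) (WReg 0))
    (Seq (StoreV (cell 0 (Const 1) (WReg 1)) (VReg 0))
    (Seq (Cond (WEqual (WLoad (Const 1)) (Const 0)) (StoreW (Const 1) (Const 1)) Skip)
         (SetW 2 (Const 2)))))"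

definition level_test :: test where
  "level_test = Not (WLess (WReg 1) (Op Times (Const 2) (WReg 2)))"

definition insert_procedure :: com where
  "insert_procedure =
    Seq place
    (Seq (While level_test level_step)
    (Seq (StoreW (Const 0) (Op Plus (WReg 1) (Const 1)))
         (SetW 0 (WLoad (Const 1)))))"

text \<open>At the start of a block the two cells still hold the counters of the previous block.\<close>

definition cnt :: "heap \<Rightarrow> nat \<Rightarrow> nat \<Rightarrow> nat" where
  "cnt h k s = (if s mod 2 ^ k = 0 then 0 else wmem h (adr 1 k 0))"

definition len :: "heap \<Rightarrow> nat \<Rightarrow> nat \<Rightarrow> nat" where
  "len h k s = (if s mod 2 ^ k = 0 then 0 else wmem h (adr 2 k 0))"

definition entry :: "heap \<Rightarrow> nat \<Rightarrow> nat \<Rightarrow> nat \<times> real" where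
  "entry h k s = (wmem h (adr 0 k s), vmem h (adr 0 k s))"

text \<open>From here on, level \<open>Suc k\<close> is the level under construction and \<open>s\<close> its next output index.\<close>

definition idx1 :: "heap \<Rightarrow> nat \<Rightarrow> nat \<Rightarrow> nat" where
  "idx1 h k s = s - cnt h (Suc k) s"

text \<open>The block under construction starts at \<open>s - s mod 2 ^ Suc k\<close>, its second
  half \<open>2 ^ k\<close> later. With \<open>c\<close> entries taken from the second half,
  \<open>s mod 2 ^ Suc k - c\<close> come from the first, which is why \<open>idx1\<close> is just
  \<open>s - c\<close>.\<close>

definition idx2 :: "heap \<Rightarrow> nat \<Rightarrow> nat \<Rightarrow> nat" where
  "idx2 h k s = s - s mod 2 ^ Suc k + 2 ^ k + cnt h (Suc k) s"

definition from_second :: "heap \<Rightarrow> nat \<Rightarrow> nat \<Rightarrow> bool" where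
  "from_second h k s \<longleftrightarrow> cnt h (Suc k) s < 2 ^ k \<and>
     \<not> (s mod 2 ^ Suc k - cnt h (Suc k) s < 2 ^ k \<and>
        wmem h (adr 0 k (idx1 h k s)) + cnt h (Suc k) s < wmem h (adr 0 k (idx2 h k s)))"

definition next_entry :: "heap \<Rightarrow> nat \<Rightarrow> nat \<Rightarrow> nat \<times> real" where
  "next_entry h k s =
    (if from_second h k s then entry h k (idx2 h k s)
     else (wmem h (adr 0 k (idx1 h k s)) + cnt h (Suc k) s, vmem h (adr 0 k (idx1 h k s))))"

section \<open>Specifications of the program pieces\<close>

lemma wp_SeqI:
  "wp W P c1 Q1 f h \<Longrightarrow> (\<And>k f' h'. Q1 k f' h' \<Longrightarrow> wp W P c2 (\<lambda>k'. Q (k + k')) f' h') \<Longrightarrow>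
   wp W P (Seq c1 c2) Q f h"
  unfolding wp_simps by (rule wp_mono)

text \<open>Only what the code of one level needs: the size bounds keep all words below
  \<open>W\<close>, and the order of the tails justifies the binary search. That a merge is in
  progress is left to the invariant.\<close>

definition level_pre :: "nat \<Rightarrow> nat \<Rightarrow> nat \<Rightarrow> nat \<Rightarrow> heap \<Rightarrow> bool" where
  "level_pre t k s W h \<longleftrightarrow> room W t \<and> s + 2 * 2 ^ Suc k = t \<and> (\<forall>a. wmem h a \<le> t + 1) \<and>
     cnt h (Suc k) s \<le> 2 ^ k \<and> cnt h (Suc k) s \<le> s mod 2 ^ Suc k \<and> len h (Suc k) s \<le> s mod 2 ^ Suc k \<and>
     (\<forall>m m'. m < m' \<longrightarrow> m' < len h (Suc k) s \<longrightarrow> vmem h (adr 1 (Suc k) m) < vmem h (adr 1 (Suc k) m'))"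

lemma prepare_spec:
  assumes pre: "level_pre t k s W h" and r: "wreg f 1 = t" "wreg f 2 = 2 ^ Suc k"
  shows "wp W P prepare (\<lambda>n f' h'. n \<le> 100 \<and> h' = h \<and>
    wreg f' 1 = t \<and> wreg f' 2 = 2 ^ Suc k \<and> wreg f' 3 = s \<and> wreg f' 4 = s mod 2 ^ Suc k \<and>
    wreg f' 5 = cnt h (Suc k) s \<and> wreg f' 6 = len h (Suc k) s \<and>
    wreg f' 10 = 2 ^ k \<and> wreg f' 11 = idx1 h k s \<and> wreg f' 12 = idx2 h k s) f h"
proof -
  note lt = room_less[of W t]
  have R: "room W t" and st: "s + 2 * 2 ^ Suc k = t" and c: "cnt h (Suc k) s \<le> 2 ^ k"
    using pre by (auto simp: level_pre_def simp del: power_Suc)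
  have mem: "wmem h a \<le> t + 1" for a
    using pre by (auto simp: level_pre_def)
  have p2: "(2::nat) ^ Suc k = 2 * 2 ^ k" and half: "(2::nat) ^ Suc k div 2 = 2 ^ k" by simp_all
  have m: "s mod 2 ^ Suc k \<le> s" by simp
  have memW: "wmem h a < W" for a
    using lt[OF R] mem[of a] by simp
  have small: "2 ^ Suc k \<le> Suc t"
    using st by linarith
  have smallW: "2 * 2 ^ Suc k < W" "t < W" "s < W" "2 ^ k < W" "2 ^ Suc k < W" "s mod 2 ^ Suc k < W"
    "s - s mod 2 ^ Suc k < W" "s - s mod 2 ^ Suc k + 2 ^ k < W" "s + 2 ^ k < W" "0 < W" "2 < W"
    by (rule lt[OF R], use st p2 m in linarith)+
  have sub: "t - 2 * 2 ^ Suc k = s" using st by simp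
  show ?thesis
  proof (cases "s mod 2 ^ Suc k = 0")
    case True
    then show ?thesis
      unfolding prepare_def using r
      by (simp add: wp_simps wp_Cond idx1_def idx2_def cnt_def len_def sub half smallW del: power_Suc)
  next
    case False
    then have c: "wmem h (adr 1 (Suc k) 0) \<le> 2 ^ k"
      using c by (simp add: cnt_def)
    have "s - s mod 2 ^ Suc k + 2 ^ k + wmem h (adr 1 (Suc k) 0) < W"
      by (rule lt[OF R]) (use m st c p2 in linarith)
    moreover have "s - wmem h (adr 1 (Suc k) 0) < W"
      by (rule lt[OF R]) (use st in linarith)
    ultimately show ?thesis
      unfolding prepare_def using r False small
      by (simp add: wp_simps wp_Cond wfits_cell[OF _ _ _ _ _ R] idx1_def idx2_def cnt_def len_def sub half smallW memW
        wval_cell[of _ _ "WReg 2" "Suc k"] del: power_Suc)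
  qed
qed

lemma emit_spec:
  assumes pre: "level_pre t k s W h"
    and r: "wreg f 1 = t" "wreg f 2 = 2 ^ Suc k" "wreg f 3 = s" "wreg f 4 = s mod 2 ^ Suc k"
    "wreg f 5 = cnt h (Suc k) s" "wreg f 6 = len h (Suc k) s"
    "wreg f 10 = 2 ^ k" "wreg f 11 = idx1 h k s" "wreg f 12 = idx2 h k s"
  shows "wp W P emit (\<lambda>n f' h'. n \<le> 200 \<and>
    wreg f' 1 = t \<and> wreg f' 2 = 2 ^ Suc k \<and> wreg f' 6 = len h (Suc k) s \<and>
    wreg f' 7 = 0 \<and> wreg f' 8 = len h (Suc k) s \<and> vreg f' 0 = snd (next_entry h k s) \<and>
    wmem h' = (wmem h)(adr 0 (Suc k) s := fst (next_entry h k s),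
             adr 1 (Suc k) 0 := cnt h (Suc k) s + (if from_second h k s then 1 else 0)) \<and>
    vmem h' = (vmem h)(adr 0 (Suc k) s := snd (next_entry h k s))) f h"
proof -
  note lt = room_less[of W t]
  have R: "room W t" and st: "s + 2 * 2 ^ Suc k = t" and c: "cnt h (Suc k) s \<le> 2 ^ k"
    and l: "len h (Suc k) s \<le> s mod 2 ^ Suc k"
    using pre by (auto simp: level_pre_def simp del: power_Suc)
  have mem: "wmem h a \<le> t + 1" for a
    using pre by (auto simp: level_pre_def)
  have p2: "(2::nat) ^ Suc k = 2 * 2 ^ k" by simp
  have m: "s mod 2 ^ Suc k \<le> s" by simp
  have memW: "wmem h a < W" for a
    using lt[OF R] mem[of a] by simp
  have memW': "wmem h a + cnt h (Suc k) s < W" for a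
    by (rule lt[OF R]) (use mem[of a] c st p2 in linarith)
  have small: "s \<le> Suc t" "2 ^ k \<le> Suc t" "2 ^ Suc k \<le> Suc t" "idx1 h k s \<le> Suc t" "idx2 h k s \<le> Suc t"
    "cnt h (Suc k) s \<le> t" "s mod 2 ^ Suc k \<le> t" "len h (Suc k) s \<le> Suc t"
    unfolding idx1_def idx2_def using st p2 m c l by linarith+
  have smallW: "s < W" "2 ^ k < W" "2 ^ Suc k < W" "idx1 h k s < W" "idx2 h k s < W"
    "cnt h (Suc k) s < W" "Suc (cnt h (Suc k) s) < W" "s mod 2 ^ Suc k < W"
    "s mod 2 ^ Suc k - cnt h (Suc k) s < W" "len h (Suc k) s < W" "0 < W" "Suc 0 < W"
    by (rule lt[OF R], use small in linarith)+
  have test: "tfits W f h second_first" "tval f h second_first \<longleftrightarrow> from_second h k s"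
    "tcost second_first \<le> 100"
    unfolding second_first_def using r small
    by (simp_all add: wfits_cell[OF _ _ _ _ _ R] wval_cell[of _ _ "WReg 10" k] memW memW' smallW
      from_second_def del: power_Suc)
  show ?thesis
    unfolding emit_def using r small test
    by (cases "from_second h k s")
      (simp_all add: wp_simps wp_Cond wfits_cell[OF _ _ _ _ _ R] wval_cell[of _ _ "WReg 2" "Suc k"]
         wval_cell[of _ _ "WReg 10" k] memW memW' smallW next_entry_def entry_def
         del: power_Suc)
qed

lemma search_spec:
  assumes R: "room W t" and r: "wreg f 2 = 2 ^ Suc k" "wreg f 7 = 0" "wreg f 8 = l"
    and l: "l < 2 ^ Suc k" "2 ^ Suc k \<le> t"
    and sorted: "\<And>m m'. m < m' \<Longrightarrow> m' < l \<Longrightarrow> vmem h (adr 1 (Suc k) m) < vmem h (adr 1 (Suc k) m')"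
  shows "wp W P search (\<lambda>n f' h'. n \<le> (k + 2) * 60 \<and> h' = h \<and>
    wreg f' 1 = wreg f 1 \<and> wreg f' 2 = 2 ^ Suc k \<and> wreg f' 6 = wreg f 6 \<and>
    vreg f' 0 = vreg f 0 \<and> wreg f' 7 \<le> l \<and>
    (\<forall>m < wreg f' 7. vmem h (adr 1 (Suc k) m) < vreg f 0) \<and>
    (\<forall>m. wreg f' 7 \<le> m \<longrightarrow> m < l \<longrightarrow> vreg f 0 \<le> vmem h (adr 1 (Suc k) m))) f h"
proof -
  \<comment> \<open>The remaining interval is shorter than \<open>2 ^ d\<close>, so \<open>d\<close>
    is the budget for \<open>wp_While\<close>. Fewer than \<open>2 ^ Suc k\<close> tails allow to
    start with \<open>d = Suc k\<close>.\<close>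
  define I where "I d f' h' \<longleftrightarrow> h' = h \<and> wreg f' 8 - wreg f' 7 < 2 ^ d \<and> wreg f' 7 \<le> wreg f' 8 \<and>
     wreg f' 8 \<le> l \<and> wreg f' 1 = wreg f 1 \<and> wreg f' 2 = 2 ^ Suc k \<and> wreg f' 6 = wreg f 6 \<and>
     vreg f' 0 = vreg f 0 \<and>
    (\<forall>m < wreg f' 7. vmem h (adr 1 (Suc k) m) < vreg f 0) \<and>
    (\<forall>m. wreg f' 8 \<le> m \<longrightarrow> m < l \<longrightarrow> vreg f 0 \<le> vmem h (adr 1 (Suc k) m))" for d :: nat and f' :: frame and h' :: heap
  note lt = room_less[of W t]
  have lW: "x < W" if "x \<le> 2 * l + 6" for x
    by (rule lt[OF R]) (use that l in linarith)
  have pW: "2 ^ Suc k < W"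
    by (rule lt[OF R]) (use l in linarith)
  have "wp W P search (\<lambda>n f' h'. n \<le> (Suc k + 1) * (1 + tcost (WLess (WReg 7) (WReg 8)) + 30) \<and>
     \<not> tval f' h' (WLess (WReg 7) (WReg 8)) \<and> (\<exists>d \<le> Suc k. I d f' h')) f h"
    unfolding search_def
  proof (rule wp_While)
    show "I (Suc k) f h"
      using r l by (simp add: I_def)
  next
    fix d f' h' assume "I d f' h'"
    then show "tfits W f' h' (WLess (WReg 7) (WReg 8))"
      by (auto simp: I_def intro: lW)
  next
    fix d f' h' assume I: "I d f' h'" and lohi: "tval f' h' (WLess (WReg 7) (WReg 8))"
    define lo hi mid where "lo = wreg f' 7" "hi = wreg f' 8" "mid = (lo + hi) div 2"
    from I have h: "h' = h" "hi - lo < 2 ^ d" "hi \<le> l" "wreg f' 2 = 2 ^ Suc k" "vreg f' 0 = vreg f 0"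
      and lo: "\<And>m. m < lo \<Longrightarrow> vmem h (adr 1 (Suc k) m) < vreg f 0"
      and hi: "\<And>m. hi \<le> m \<Longrightarrow> m < l \<Longrightarrow> vreg f 0 \<le> vmem h (adr 1 (Suc k) m)"
      by (auto simp: I_def lo_hi_mid_def)
    have "lo < hi" using lohi by (simp add: lo_hi_mid_def)
    then have mid: "lo \<le> mid" "mid < hi" by (auto simp: lo_hi_mid_def)
    have d: "0 < d" using h(2) \<open>lo < hi\<close> by (cases d) auto
    then obtain d' where d': "d = Suc d'" by (cases d) auto
    \<comment> \<open>A move to the right discards \<open>mid\<close> itself, so both possible
      remainders are shorter than \<open>2 ^ d'\<close>.\<close>
    have half: "hi - (mid + 1) < 2 ^ d'" "mid - lo < 2 ^ d'"
      using h(2) mid unfolding d' by (auto simp: lo_hi_mid_def)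
    have fits: "wfits W (f'\<lparr>wreg := (wreg f')(9 := mid)\<rparr>) h (cell 1 (WReg 2) (WReg 9))"
      using h l mid by (intro wfits_cell[OF _ _ _ _ _ R]) (auto intro: lW pW simp del: power_Suc)
    have step1: "vmem h (adr 1 (Suc k) m) < vreg f 0"
      if "vmem h (adr 1 (Suc k) mid) < vreg f 0" "m < mid + 1" for m
    proof (cases "m = mid")
      case False
      then show ?thesis using sorted[of m mid] that mid h(3) by auto
    qed (use that in simp)
    have step2: "vreg f 0 \<le> vmem h (adr 1 (Suc k) m)"
      if "\<not> vmem h (adr 1 (Suc k) mid) < vreg f 0" "mid \<le> m" "m < l" for m
    proof (cases "m = mid")
      case False
      then show ?thesis using sorted[of mid m] that by auto
    qed (use that in simp)
    have *: "wreg f' 7 = lo" "wreg f' 8 = hi" by (simp_all add: lo_hi_mid_def)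
    have **: "(lo + hi) div 2 = mid" by (simp add: lo_hi_mid_def)
    have W: "lo < W" "hi < W" "lo + hi < W" "mid < W" "Suc mid < W" "2 < W" "1 < W" "Suc 0 < W"
      using mid h(3) by (auto intro!: lW)
    show "0 < d \<and> wp W P (Seq (SetW 9 (Op Divide (Op Plus (WReg 7) (WReg 8)) (Const 2)))
      (Cond (VLess (VLoad (cell 1 (WReg 2) (WReg 9))) (VReg 0))
        (SetW 7 (Op Plus (WReg 9) (Const 1)))
        (SetW 8 (WReg 9)))) (\<lambda>k f' h'. k \<le> 30 \<and> I (d - 1) f' h') f' h'"
      using I d fits half lo hi step1 step2 mid h
      by (auto simp: wp_simps wp_Cond * ** W wval_cell[of _ _ "WReg 2" "Suc k"] I_def d' simp del: power_Suc)
  qed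
  then show ?thesis
  proof (rule wp_mono)
    fix n f' h'
    assume "n \<le> (Suc k + 1) * (1 + tcost (WLess (WReg 7) (WReg 8)) + 30) \<and>
     \<not> tval f' h' (WLess (WReg 7) (WReg 8)) \<and> (\<exists>d \<le> Suc k. I d f' h')"
    then obtain d where n: "n \<le> (Suc k + 1) * 34" and "\<not> wreg f' 7 < wreg f' 8" and I: "I d f' h'"
      by auto
    then have "wreg f' 8 = wreg f' 7" by (simp add: I_def)
    moreover have "n \<le> (k + 2) * 60" using n by simp
    ultimately show "n \<le> (k + 2) * 60 \<and> h' = h \<and>
      wreg f' 1 = wreg f 1 \<and> wreg f' 2 = 2 ^ Suc k \<and> wreg f' 6 = wreg f 6 \<and>
      vreg f' 0 = vreg f 0 \<and> wreg f' 7 \<le> l \<and>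
      (\<forall>m < wreg f' 7. vmem h (adr 1 (Suc k) m) < vreg f 0) \<and>
      (\<forall>m. wreg f' 7 \<le> m \<longrightarrow> m < l \<longrightarrow> vreg f 0 \<le> vmem h (adr 1 (Suc k) m))"
      using I unfolding I_def by auto
  qed
qed

lemma record_tail_spec:
  assumes R: "room W t" and r: "wreg f 2 = 2 ^ Suc k" "wreg f 6 = l" "wreg f 7 = lo"
    and le: "lo \<le> l" "l \<le> t" "2 * 2 ^ Suc k \<le> t" and mem: "wmem h 1 \<le> t + 1"
  shows "wp W P record_tail (\<lambda>n f' h'. n \<le> 200 \<and>
    wreg f' 1 = wreg f 1 \<and> wreg f' 2 = 2 ^ Suc (Suc k) \<and>
    wmem h' = (let l' = if lo = l then Suc l else l in
      (wmem h)(adr 2 (Suc k) 0 := l', 1 := max (wmem h 1) l')) \<and>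
    vmem h' = (vmem h)(adr 1 (Suc k) lo := vreg f 0)) f h"
proof -
  note lt = room_less[of W t]
  have W: "lo < W" "l < W" "Suc l < W" "2 ^ Suc k < W" "0 < W" "Suc 0 < W" "1 < W" "2 < W"
    "wmem h 1 < W" "2 * 2 ^ Suc k < W"
    by (rule lt[OF R], use le mem in linarith)+
  have small: "lo \<le> Suc t" "2 ^ Suc k \<le> Suc t"
    using le by linarith+
  show ?thesis
    unfolding record_tail_def using r small W le
    by (cases "lo = l"; cases "wmem h 1 < (if lo = l then Suc l else l)")
      (simp_all add: wp_simps wp_Cond wfits_cell[OF _ _ _ _ _ R] wval_cell[of _ _ "WReg 2" "Suc k"]
        fun_upd_idem max_absorb1 max_absorb2
         power_Suc[of 2 "Suc k"] del: power_Suc)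
qed

text \<open>The interface between code and invariant: a relation of heaps without registers.
  \<open>lo\<close> is the place that patience sorting assigns to the new entry, and
  \<open>max (Suc lo)\<close> is the form that \<open>tails_snoc\<close> expects.\<close>

definition level_post :: "nat \<Rightarrow> nat \<Rightarrow> heap \<Rightarrow> heap \<Rightarrow> bool" where
  "level_post k s h h' \<longleftrightarrow>
    (\<exists>lo \<le> len h (Suc k) s.
      (\<forall>m < lo. vmem h (adr 1 (Suc k) m) < snd (next_entry h k s)) \<and>
      (\<forall>m. lo \<le> m \<longrightarrow> m < len h (Suc k) s \<longrightarrow> snd (next_entry h k s) \<le> vmem h (adr 1 (Suc k) m)) \<and>
      wmem h' = (let l' = max (Suc lo) (len h (Suc k) s) in
        (wmem h)(adr 0 (Suc k) s := fst (next_entry h k s),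
           adr 1 (Suc k) 0 := cnt h (Suc k) s + (if from_second h k s then 1 else 0),
           adr 2 (Suc k) 0 := l', 1 := max (wmem h 1) l')) \<and>
      vmem h' = (vmem h)(adr 0 (Suc k) s := snd (next_entry h k s),
           adr 1 (Suc k) lo := snd (next_entry h k s)))"

lemma level_step_spec:
  assumes pre: "level_pre t k s W h" and r: "wreg f 1 = t" "wreg f 2 = 2 ^ Suc k"
  shows "wp W P level_step (\<lambda>n f' h'. n \<le> 700 * (k + 1) \<and>
    wreg f' 1 = t \<and> wreg f' 2 = 2 ^ Suc (Suc k) \<and> level_post k s h h') f h"
proof -
  let ?y = "snd (next_entry h k s)" and ?l = "len h (Suc k) s"
  let ?wm = "(wmem h)(adr 0 (Suc k) s := fst (next_entry h k s),
             adr 1 (Suc k) 0 := cnt h (Suc k) s + (if from_second h k s then 1 else 0))"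
  have R: "room W t" and st: "s + 2 * 2 ^ Suc k = t" and l: "?l \<le> s mod 2 ^ Suc k"
    and sorted: "\<And>m m'. m < m' \<Longrightarrow> m' < ?l \<Longrightarrow> vmem h (adr 1 (Suc k) m) < vmem h (adr 1 (Suc k) m')"
    and mem: "wmem h 1 \<le> t + 1"
    using pre by (auto simp: level_pre_def simp del: power_Suc)
  have l': "?l < 2 ^ Suc k"
    using l by (rule le_less_trans) simp
  have t: "2 * 2 ^ Suc k \<le> t" "2 ^ Suc k \<le> t" "?l \<le> t" using st l' by linarith+
  show ?thesis
    unfolding level_step_def
  proof (rule wp_SeqI[OF prepare_spec[OF assms]], elim conjE, goal_cases)
    case (1 n1 f1 h1)
    note r1 = this(3-)
    show ?case unfolding \<open>h1 = h\<close>
    proof (rule wp_SeqI[OF emit_spec[OF pre r1]], elim conjE, goal_cases)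
      case (1 n2 f2 h2)
      note r2 = this
      \<comment> \<open>\<open>emit\<close> writes a value cell with tag 0. The tails have tag 1, so
        their order in \<open>h\<close> is still available to the search.\<close>
      have vm: "vmem h2 (adr 1 (Suc k) m) = vmem h (adr 1 (Suc k) m)" for m
        using r2 by (simp add: adr_eq_iff)
      show ?case
      proof (rule wp_SeqI[OF search_spec[OF R r2(3,5,6) l' t(2)]], goal_cases)
        case (1 m m')
        then show ?case using sorted vm by simp
      next
        case (2 n3 f3 h3)
        then have r3: "n3 \<le> (k + 2) * 60" "h3 = h2" "wreg f3 1 = t" "wreg f3 2 = 2 ^ Suc k"
          "wreg f3 6 = ?l" "vreg f3 0 = ?y" "wreg f3 7 \<le> ?l"
          and lo: "\<forall>m < wreg f3 7. vmem h (adr 1 (Suc k) m) < ?y"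
            "\<forall>m. wreg f3 7 \<le> m \<longrightarrow> m < ?l \<longrightarrow> ?y \<le> vmem h (adr 1 (Suc k) m)"
          using r2 by (auto simp: vm adr_eq_iff)
        have mem2: "wmem h2 1 \<le> t + 1" using mem r2 by simp
        have max: "max (Suc (wreg f3 7)) ?l = (if wreg f3 7 = ?l then Suc ?l else ?l)"
          using r3(7) by auto
        show ?case unfolding \<open>h3 = h2\<close>
        proof (rule wp_mono[OF record_tail_spec[OF R r3(4,5) refl r3(7) t(3,1) mem2]], elim conjE, goal_cases)
          case (1 n4 f4 h4)
          have "level_post k s h h4"
            unfolding level_post_def
            using r3(7) lo 1 r2 r3(6)
            by (intro exI[of _ "wreg f3 7"] conjI) (simp_all add: Let_def max del: max_def)
          moreover have "n1 + (n2 + (n3 + n4)) \<le> 700 * (k + 1)"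
            using \<open>n1 \<le> 100\<close> \<open>n2 \<le> 200\<close> \<open>n4 \<le> 200\<close> r3(1) by simp
          ultimately show ?case using 1 r3(3) by simp
        qed
      qed
    qed
  qed
qed

lemma place_spec:
  assumes R: "room W t" and h: "wmem h 0 = t" "\<And>a. wmem h a \<le> t + 1" and f: "wreg f 0 \<le> t + 1"
  shows "wp W P place (\<lambda>n f' h'. n \<le> 60 \<and> wreg f' 1 = t \<and> wreg f' 2 = 2 \<and>
    wmem h' = (wmem h)(adr 0 0 t := wreg f 0, 1 := max 1 (wmem h 1)) \<and>
    vmem h' = (vmem h)(adr 0 0 t := vreg f 0)) f h"
proof -
  note lt = room_less[of W t]
  have W: "t < W" "Suc t < W" "0 < W" "Suc 0 < W" "1 < W" "2 < W" "wreg f 0 < W"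
    by (rule lt[OF R], use f in linarith)+
  have memW: "wmem h a < W" for a
    by (rule lt[OF R]) (use h(2)[of a] in linarith)
  show ?thesis
    unfolding place_def using W memW h(1)
    by (cases "wmem h 1 = 0")
      (simp_all add: wp_simps wp_Cond wfits_cell[OF _ _ _ _ _ R] wval_cell[of _ _ "Const (Suc 0)" 0]
        fun_upd_idem max_absorb2 Suc_le_eq)
qed

text \<open>\<open>J\<close> stands for any invariant of the loop over levels, which separates
  symbolic execution from the merging argument. At most \<open>K\<close> levels with a binary search
  of \<open>O(K)\<close> steps each give the square.\<close>

lemma insert_procedure_spec:
  assumes R: "room W t" and h: "wmem h 0 = t" "\<And>a. wmem h a \<le> t + 1" and f: "wreg f 0 \<le> t + 1"
    and K: "t < 2 ^ K"
    and J0: "\<And>h1. wmem h1 = (wmem h)(adr 0 0 t := wreg f 0, 1 := max 1 (wmem h 1)) \<Longrightarrow>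
        vmem h1 = (vmem h)(adr 0 0 t := vreg f 0) \<Longrightarrow> J 0 h1"
    and bound: "\<And>k h a. J k h \<Longrightarrow> wmem h a \<le> t + 1"
    and pre: "\<And>k s h. J k h \<Longrightarrow> s + 2 * 2 ^ Suc k = t \<Longrightarrow> level_pre t k s W h"
    and post: "\<And>k s h h'. J k h \<Longrightarrow> s + 2 * 2 ^ Suc k = t \<Longrightarrow> level_post k s h h' \<Longrightarrow> J (Suc k) h'"
  shows "wp W P insert_procedure (\<lambda>n f' h'. n \<le> 2000 * (K + 1) ^ 2 \<and>
    (\<exists>k h2. J k h2 \<and> t < 2 * 2 ^ Suc k \<and> wmem h' = (wmem h2)(0 := t + 1) \<and> vmem h' = vmem h2 \<and>
       wreg f' 0 = wmem h2 1)) f h"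
proof -
  note lt = room_less[of W t]
  have W: "t < W" "Suc t < W" "0 < W" "Suc 0 < W" "1 < W" "2 < W" "wreg f 0 < W"
    by (rule lt[OF R], use f in linarith)+
  have memW: "wmem h a < W" for a
    by (rule lt[OF R]) (use h(2)[of a] in linarith)
  \<comment> \<open>The bound \<open>t + 2\<close> lets \<open>2 * p\<close> fit when the test is
    evaluated for the last time. It also covers \<open>t < 2\<close>, where the initial
    \<open>p = 2\<close> exceeds \<open>t\<close>.\<close>
  define I where "I m f h \<longleftrightarrow> (\<exists>k. J k h \<and> wreg f 1 = t \<and> wreg f 2 = 2 ^ Suc k \<and>
     2 ^ Suc k \<le> t + 2 \<and> k + m = K)" for m :: nat and f :: frame and h :: heap
  have tv: "tval f h level_test \<longleftrightarrow> 2 * wreg f 2 \<le> wreg f 1" for f h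
    by (auto simp: level_test_def)
  have loop: "wp W P (While level_test level_step)
      (\<lambda>k f' h'. k \<le> (K + 1) * (1 + tcost level_test + 700 * K) \<and> \<not> tval f' h' level_test \<and>
         (\<exists>m \<le> K. I m f' h')) f1 h1"
    if "I K f1 h1" for f1 h1
    using that
  proof (rule wp_While)
    fix m f h assume "I m f h"
    then obtain k where k: "wreg f 1 = t" "wreg f 2 = 2 ^ Suc k" "2 ^ Suc k \<le> t + 2"
      by (auto simp: I_def)
    have "2 ^ Suc k < W" "2 * 2 ^ Suc k < W"
      by (rule lt[OF R], use k(3) in linarith)+
    with k W show "tfits W f h level_test"
      by (simp add: level_test_def del: power_Suc)
  next
    fix m f h assume "I m f h" and test: "tval f h level_test"
    then obtain k where k: "J k h" "wreg f 1 = t" "wreg f 2 = 2 ^ Suc k" "k + m = K"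
      by (auto simp: I_def)
    with test have le: "2 * 2 ^ Suc k \<le> t" by (simp add: tv)
    then have "(2::nat) ^ Suc (Suc k) < 2 ^ K" using K by simp
    then have "Suc (Suc k) < K" by (simp only: power_strict_increasing_iff)
    then have m: "0 < m" "k + 1 \<le> K" using k(4) by auto
    obtain s where s: "s + 2 * 2 ^ Suc k = t" using le by (metis le_add_diff_inverse2)
    have "wp W P level_step (\<lambda>n f' h'. n \<le> 700 * K \<and> I (m - 1) f' h') f h"
    proof (rule wp_mono[OF level_step_spec[OF pre[OF k(1) s] k(2,3)]], elim conjE, goal_cases)
      case (1 n f' h')
      have "n \<le> 700 * K" using 1(1) mult_le_mono2[OF m(2), of 700] by (rule order_trans)
      moreover have "I (m - 1) f' h'"
        unfolding I_def using post[OF k(1) s 1(4)] 1 k(4) m le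
        by (intro exI[of _ "Suc k"]) auto
      ultimately show ?case ..
    qed
    with m show "0 < m \<and> wp W P level_step (\<lambda>n f' h'. n \<le> 700 * K \<and> I (m - 1) f' h') f h"
      by simp
  qed
  show ?thesis
    unfolding insert_procedure_def
  proof (rule wp_SeqI[OF place_spec[OF R h f]], elim conjE, goal_cases)
    case (1 n1 f1 h1)
    then have "I K f1 h1"
      unfolding I_def by (intro exI[of _ 0]) (simp add: J0)
    then show ?case
    proof (rule wp_SeqI[OF loop], goal_cases)
      case (1 n2 f2 h2)
      then obtain k where k: "J k h2" "wreg f2 1 = t" "wreg f2 2 = 2 ^ Suc k" "\<not> 2 * 2 ^ Suc k \<le> t"
        by (auto simp: I_def tv)
      have "wmem h2 1 < W"
        by (rule lt[OF R]) (use bound[OF k(1), of 1] in linarith)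
      moreover have "n1 + (n2 + 10) \<le> 2000 * (K + 1) ^ 2"
        using 1 \<open>n1 \<le> 60\<close> by (simp add: level_test_def power2_eq_square algebra_simps)
      ultimately show ?case
        using k W by (auto simp: wp_simps simp del: power_Suc intro!: exI[of _ k] exI[of _ h2])
    qed
  qed
qed

section \<open>The invariant\<close>

definition block :: "heap \<Rightarrow> nat \<Rightarrow> nat \<Rightarrow> (nat \<times> real) list" where
  "block h k j = map (entry h k) [j * 2 ^ k..<(j + 1) * 2 ^ k]"

text \<open>\<open>A m\<close> is the array after \<open>m\<close> insertions.\<close>

definition complete_block :: "(nat \<Rightarrow> real list) \<Rightarrow> heap \<Rightarrow> nat \<Rightarrow> nat \<Rightarrow> bool" where
  "complete_block A h k j \<longleftrightarrow> inserted 0 (block h k j) (A (j * 2 ^ k)) (A ((j + 1) * 2 ^ k)) \<and>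
     LIS (map snd (block h k j)) \<le> wmem h 1"

definition target :: "heap \<Rightarrow> nat \<Rightarrow> nat \<Rightarrow> (nat \<times> real) list" where
  "target h k s = (let j = s div 2 ^ Suc k in merge 0 (block h k (2 * j)) (block h k (2 * j + 1)))"

text \<open>The output is a prefix of the merge, the rest is the merge from the two cursors on, and
  the tail cells describe the prefix. \<open>r\<close> is a parameter because after the last step of
  a block it is the full length, while \<open>Suc s mod 2 ^ Suc k\<close> is already 0.\<close>

definition merging :: "heap \<Rightarrow> nat \<Rightarrow> nat \<Rightarrow> nat \<Rightarrow> nat \<Rightarrow> nat \<Rightarrow> bool" where
  "merging h k s r c l \<longleftrightarrow>
    (let j = s div 2 ^ Suc k; X = block h k (2 * j); Y = block h k (2 * j + 1); M = merge 0 X Y;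
         b = j * 2 ^ Suc k in
      c \<le> r \<and> c \<le> 2 ^ k \<and> r - c \<le> 2 ^ k \<and>
      map (entry h (Suc k)) [b..<b + r] = take r M \<and>
      drop r M = merge c (drop (r - c) X) (drop c Y) \<and>
      tails (map snd (take r M)) (map (\<lambda>m. vmem h (adr 1 (Suc k) m)) [0..<l]))"

definition level_inv :: "(nat \<Rightarrow> real list) \<Rightarrow> heap \<Rightarrow> nat \<Rightarrow> nat \<Rightarrow> bool" where
  "level_inv A h k s \<longleftrightarrow> (\<forall>j. (j + 1) * 2 ^ Suc k \<le> s \<longrightarrow> complete_block A h (Suc k) j) \<and>
     merging h k s (s mod 2 ^ Suc k) (cnt h (Suc k) s) (len h (Suc k) s)"

lemma length_block [simp]: "length (block h k j) = 2 ^ k"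
  by (simp add: block_def)

lemma nth_block: "m < 2 ^ k \<Longrightarrow> block h k j ! m = entry h k (j * 2 ^ k + m)"
  by (simp add: block_def)

lemma block_cong:
  "(\<And>s. j * 2 ^ k \<le> s \<Longrightarrow> s < (j + 1) * 2 ^ k \<Longrightarrow> entry h' k s = entry h k s) \<Longrightarrow> block h' k j = block h k j"
  by (simp add: block_def)

text \<open>With the counters read as 0, a new block requires nothing of the heap, so no cell needs
  a reset.\<close>

lemma merging_0: "s mod 2 ^ Suc k = 0 \<Longrightarrow> merging h k s (s mod 2 ^ Suc k) (cnt h (Suc k) s) (len h (Suc k) s)"
  by (simp add: merging_def cnt_def len_def tails_Nil Let_def)

lemma level_inv_0: "level_inv A h k 0"
  unfolding level_inv_def using merging_0[of 0] by simp

lemma complete_mono: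
  assumes "complete_block A h k j"
    and "\<And>s. j * 2 ^ k \<le> s \<Longrightarrow> s < (j + 1) * 2 ^ k \<Longrightarrow> entry h' k s = entry h k s"
    and "wmem h 1 \<le> wmem h' 1" and "\<And>m. m \<le> (j + 1) * 2 ^ k \<Longrightarrow> A' m = A m"
  shows "complete_block A' h' k j"
  using assms(1,3) block_cong[of j k h' h] assms(2) assms(4) unfolding complete_block_def by auto

lemma mod_div_bounds:
  fixes s :: nat
  shows "s div 2 ^ k * 2 ^ k \<le> s" "s < (s div 2 ^ k + 1) * 2 ^ k" "s = s div 2 ^ k * 2 ^ k + s mod 2 ^ k"
    "s mod 2 ^ k < 2 ^ k"
proof -
  show 1: "s = s div 2 ^ k * 2 ^ k + s mod 2 ^ k" by (rule div_mult_mod_eq[symmetric])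
  show 2: "s mod 2 ^ k < 2 ^ k" by simp
  show "s div 2 ^ k * 2 ^ k \<le> s" by (rule div_times_less_eq_dividend)
  show "s < (s div 2 ^ k + 1) * 2 ^ k" using 1 2 unfolding add_mult_distrib by linarith
qed

text \<open>A level depends on its entries below \<open>s\<close>, its counters and tails, and the
  halves of its current block, which end by \<open>s + 2 ^ Suc k\<close>. At \<open>s = 0\<close> no
  half has been read, so the lower level may still be written.\<close>

lemma level_inv_frame:
  assumes "level_inv A h k s"
    and e1: "\<And>s'. s' < s \<Longrightarrow> entry h' (Suc k) s' = entry h (Suc k) s'"
    and e0: "\<And>s'. 0 < s \<Longrightarrow> s' < s + 2 ^ Suc k \<Longrightarrow> entry h' k s' = entry h k s'"
    and w: "\<And>i. i \<in> {1, 2} \<Longrightarrow> wmem h' (adr i (Suc k) 0) = wmem h (adr i (Suc k) 0)"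
    and v: "\<And>m. vmem h' (adr 1 (Suc k) m) = vmem h (adr 1 (Suc k) m)"
    and best: "wmem h 1 \<le> wmem h' 1" and A: "\<And>m. m \<le> s \<Longrightarrow> A' m = A m"
  shows "level_inv A' h' k s"
  unfolding level_inv_def
proof
  show "\<forall>j. (j + 1) * 2 ^ Suc k \<le> s \<longrightarrow> complete_block A' h' (Suc k) j"
  proof (intro allI impI)
    fix j assume j: "(j + 1) * 2 ^ Suc k \<le> s"
    with assms(1) have "complete_block A h (Suc k) j" unfolding level_inv_def by blast
    then show "complete_block A' h' (Suc k) j"
      by (rule complete_mono) (use j best in \<open>auto intro!: e1 A simp del: power_Suc\<close>)
  qed
  show "merging h' k s (s mod 2 ^ Suc k) (cnt h' (Suc k) s) (len h' (Suc k) s)"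
  proof (cases "s mod 2 ^ Suc k = 0")
    case True then show ?thesis by (rule merging_0)
  next
    case False
    then have s: "0 < s" by (cases s) auto
    let ?j = "s div 2 ^ Suc k"
    have 1: "?j * 2 ^ Suc k \<le> s" by (rule mod_div_bounds)
    have 2: "(2 * ?j + 1 + 1) * 2 ^ k = ?j * 2 ^ Suc k + 2 ^ Suc k" "(2 * ?j + 1) * 2 ^ k \<le> ?j * 2 ^ Suc k + 2 ^ Suc k"
      by (simp_all add: algebra_simps)
    have X: "block h' k (2 * ?j) = block h k (2 * ?j)" "block h' k (2 * ?j + 1) = block h k (2 * ?j + 1)"
      by (rule block_cong, rule e0[OF s], use 1 2 in linarith)+
    have E: "map (entry h' (Suc k)) [?j * 2 ^ Suc k..<?j * 2 ^ Suc k + s mod 2 ^ Suc k]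
        = map (entry h (Suc k)) [?j * 2 ^ Suc k..<?j * 2 ^ Suc k + s mod 2 ^ Suc k]"
      using e1 mod_div_bounds(3)[of s "Suc k"] by (intro map_cong) auto
    have "cnt h' (Suc k) s = cnt h (Suc k) s" "len h' (Suc k) s = len h (Suc k) s"
      using w by (simp_all add: cnt_def len_def)
    with X E v assms(1) show ?thesis
      unfolding level_inv_def merging_def Let_def by (simp only:)
  qed
qed

text \<open>One pass of the code performs one step of \<open>merge\<close> and one step of patience
  sorting. It writes on level \<open>Suc k\<close> only, so both halves on level \<open>k\<close>
  stay as they are.\<close>

lemma merging_step:
  assumes m: "merging h k s (s mod 2 ^ Suc k) (cnt h (Suc k) s) (len h (Suc k) s)"
    and post: "level_post k s h h'"
  shows "merging h' k s (Suc (s mod 2 ^ Suc k)) (wmem h' (adr 1 (Suc k) 0)) (wmem h' (adr 2 (Suc k) 0))"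
    and "target h' k s = target h k s"
    and "wmem h' 1 = max (wmem h 1) (wmem h' (adr 2 (Suc k) 0))"
    and "next_entry h k s = target h k s ! (s mod 2 ^ Suc k)"
proof -
  define r j c l where "r = s mod 2 ^ Suc k" "j = s div 2 ^ Suc k" "c = cnt h (Suc k) s" "l = len h (Suc k) s"
  note defs = this
  define X Y where "X = block h k (2 * j)" "Y = block h k (2 * j + 1)"
  define M where "M = merge 0 X Y"
  define b where "b = j * 2 ^ Suc k"
  define y where "y = snd (next_entry h k s)"
  have s: "s = b + r" and r: "r < 2 ^ Suc k"
    unfolding defs b_def by (rule mod_div_bounds)+
  have len: "length X = 2 ^ k" "length Y = 2 ^ k" "length M = 2 ^ Suc k"
    by (simp_all add: X_Y_def M_def)
  from m have m: "c \<le> r" "c \<le> 2 ^ k" "r - c \<le> 2 ^ k"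
      and e: "map (entry h (Suc k)) [b..<b + r] = take r M"
      and d: "drop r M = merge c (drop (r - c) X) (drop c Y)"
      and T: "tails (map snd (take r M)) (map (\<lambda>m. vmem h (adr 1 (Suc k) m)) [0..<l])"
    unfolding merging_def Let_def defs(1,3,4)[symmetric] defs(2)[symmetric] X_Y_def[symmetric]
      M_def[symmetric] b_def[symmetric] by blast+
  from post obtain lo where lo: "lo \<le> l"
      "\<And>m. m < lo \<Longrightarrow> vmem h (adr 1 (Suc k) m) < y"
      "\<And>m. lo \<le> m \<Longrightarrow> m < l \<Longrightarrow> y \<le> vmem h (adr 1 (Suc k) m)"
    and wm: "wmem h' = (wmem h)(adr 0 (Suc k) s := fst (next_entry h k s),
           adr 1 (Suc k) 0 := c + (if from_second h k s then 1 else 0),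
           adr 2 (Suc k) 0 := max (Suc lo) l, 1 := max (wmem h 1) (max (Suc lo) l))"
    and vm: "vmem h' = (vmem h)(adr 0 (Suc k) s := y, adr 1 (Suc k) lo := y)"
    unfolding level_post_def Let_def defs y_def by blast
  have e0: "entry h' k s' = entry h k s'" for s'
    unfolding entry_def wm vm by (simp add: adr_eq_iff)
  then have XY': "block h' k (2 * j) = X" "block h' k (2 * j + 1) = Y"
    unfolding X_Y_def by (simp_all add: block_def)
  show "target h' k s = target h k s"
    unfolding target_def Let_def defs(2)[symmetric] XY' by (simp only: X_Y_def)
  have tM: "target h k s = M"
    by (simp only: target_def Let_def M_def X_Y_def defs(2))
  have bk: "b = 2 * j * 2 ^ k" by (simp add: b_def)
  have i1: "idx1 h k s = 2 * j * 2 ^ k + (r - c)"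
    unfolding idx1_def defs(3)[symmetric] using m(1) s bk by simp
  have i2: "idx2 h k s = (2 * j + 1) * 2 ^ k + c"
    unfolding idx2_def defs(3)[symmetric] defs(1)[symmetric] using s bk by simp
  have X1: "entry h k (idx1 h k s) = X ! (r - c)" if "r - c < 2 ^ k"
    using nth_block[OF that] by (simp add: i1 X_Y_def)
  have Y1: "entry h k (idx2 h k s) = Y ! c" if "c < 2 ^ k"
    using nth_block[OF that] by (simp add: i2 X_Y_def)
  have wX: "wmem h (adr 0 k (idx1 h k s)) = fst (X ! (r - c))"
    "vmem h (adr 0 k (idx1 h k s)) = snd (X ! (r - c))" if "r - c < 2 ^ k"
    by (simp_all add: entry_def flip: X1[OF that])
  have wY: "wmem h (adr 0 k (idx2 h k s)) = fst (Y ! c)" if "c < 2 ^ k"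
    by (simp add: entry_def flip: Y1[OF that])
  have avail: "r - c < length X \<or> c < length Y"
    using r m len by auto
  have second: "from_second h k s \<longleftrightarrow>
      c < length Y \<and> \<not> (r - c < length X \<and> fst (X ! (r - c)) + c < fst (Y ! c))"
    unfolding from_second_def defs(1)[symmetric] defs(3)[symmetric]
    using wX wY by (auto simp: len)
  have dM: "drop r M = next_entry h k s # (if from_second h k s
      then merge (Suc c) (drop (r - c) X) (drop (Suc c) Y)
      else merge c (drop (Suc (r - c)) X) (drop c Y))"
  proof (cases "from_second h k s")
    case True
    then show ?thesis using d merge_step[OF avail, of c] second Y1 len by (simp add: next_entry_def)
  next
    case False
    then have "r - c < 2 ^ k" using second avail len by auto
    then show ?thesis using False d merge_step[OF avail, of c] second wX len
      by (auto simp: next_entry_def defs(3)[symmetric])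
  qed
  then have nM: "next_entry h k s = M ! r"
    using r len by (metis Cons_nth_drop_Suc list.inject)
  then show "next_entry h k s = target h k s ! (s mod 2 ^ Suc k)"
    by (simp add: tM defs(1))
  have tk: "take (Suc r) M = take r M @ [next_entry h k s]"
    using r len nM by (simp add: take_Suc_conv_app_nth)
  let ?c = "c + (if from_second h k s then 1 else 0)" and ?l = "max (Suc lo) l"
  have w: "wmem h' (adr 1 (Suc k) 0) = ?c" "wmem h' (adr 2 (Suc k) 0) = ?l"
    unfolding wm by (simp_all add: adr_eq_iff)
  then show "wmem h' 1 = max (wmem h 1) (wmem h' (adr 2 (Suc k) 0))"
    unfolding wm by simp
  have E: "map (entry h' (Suc k)) [b..<b + Suc r] = take (Suc r) M"
  proof -
    have "map (entry h' (Suc k)) [b..<b + r] = map (entry h (Suc k)) [b..<b + r]"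
      unfolding entry_def wm vm s by (auto simp: adr_eq_iff)
    moreover have "entry h' (Suc k) s = next_entry h k s"
      unfolding entry_def wm vm by (simp add: adr_eq_iff y_def)
    ultimately show ?thesis using e tk s by simp
  qed
  \<comment> \<open>If the entry came from the second half, \<open>Suc r - ?c\<close> is again
    \<open>r - c\<close>. Otherwise the first cursor advances.\<close>
  have D: "drop (Suc r) M = merge ?c (drop (Suc r - ?c) X) (drop ?c Y)"
  proof -
    have "drop (Suc r) M = tl (drop r M)" by (simp add: drop_Suc tl_drop)
    with dM m(1) show ?thesis by (simp add: Suc_diff_le)
  qed
  have T': "tails (map snd (take (Suc r) M)) (map (\<lambda>m. vmem h' (adr 1 (Suc k) m)) [0..<?l])"
    unfolding tk map_append list.map y_def[symmetric]
  proof (rule tails_snoc[OF T, of lo])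
    fix m assume "m < length (map (\<lambda>m. vmem h' (adr 1 (Suc k) m)) [0..<?l])"
    then show "map (\<lambda>m. vmem h' (adr 1 (Suc k) m)) [0..<?l] ! m =
      (if m = lo then y else map (\<lambda>m. vmem h (adr 1 (Suc k) m)) [0..<l] ! m)"
      unfolding vm using lo(1) by (auto simp: adr_eq_iff)
  qed (use lo in auto)
  have C: "?c \<le> Suc r" "?c \<le> 2 ^ k" "Suc r - ?c \<le> 2 ^ k"
    using second m avail len by auto
  show "merging h' k s (Suc (s mod 2 ^ Suc k)) (wmem h' (adr 1 (Suc k) 0)) (wmem h' (adr 2 (Suc k) 0))"
    unfolding merging_def Let_def w defs(1)[symmetric] defs(2)[symmetric] XY' M_def[symmetric] b_def[symmetric]
    using C E D T' by blast
qed

section \<open>The invariant of the loop over levels\<close>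

definition history :: "(nat \<Rightarrow> real list) \<Rightarrow> nat \<Rightarrow> bool" where
  "history A n \<longleftrightarrow> A 0 = [] \<and> (\<forall>m\<le>n. length (A m) = m) \<and> (\<forall>m\<le>n. \<forall>m'\<le>m. subseq (A m') (A m))"

text \<open>The state during insertion \<open>t\<close>, after the levels \<open>1, \<dots>, k\<close> have been advanced.\<close>

definition loop_inv :: "(nat \<Rightarrow> real list) \<Rightarrow> nat \<Rightarrow> nat \<Rightarrow> heap \<Rightarrow> bool" where
  "loop_inv A t k h \<longleftrightarrow> history A (t + 1) \<and> (\<forall>a. wmem h a \<le> t + 1) \<and> wmem h 1 \<le> LIS (A (t + 1)) \<and>
     (\<forall>j\<le>t. complete_block A h 0 j) \<and>
     (\<forall>k'. level_inv A h k' ((if k' < k then t + 1 else t) - 2 * 2 ^ Suc k'))"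

lemma LIS_le_length: "LIS xs \<le> length xs"
  using LIS_attained[of xs] by (auto dest: list_emb_length)

lemma length_target [simp]: "length (target h k s) = 2 ^ Suc k"
  by (simp add: target_def Let_def)

text \<open>Here the delay is used. The lower level has already been advanced in this insertion, to
  \<open>t + 1 - 2 * 2 ^ k\<close>, which is beyond \<open>s + 2 ^ Suc k\<close>. The block
  containing \<open>s\<close> ends no later than that, so both its halves are complete.\<close>

lemma loop_inv_target:
  assumes loop_inv: "loop_inv A t k h" and s: "s + 2 * 2 ^ Suc k = t"
  shows "inserted 0 (target h k s) (A (s div 2 ^ Suc k * 2 ^ Suc k)) (A ((s div 2 ^ Suc k + 1) * 2 ^ Suc k))"
proof -
  let ?j = "s div 2 ^ Suc k"
  have j: "?j * 2 ^ Suc k \<le> s" by (rule mod_div_bounds)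
  have *: "complete_block A h k i" if "(i + 1) * 2 ^ k \<le> s + 2 ^ Suc k" for i
  proof (cases k)
    case 0
    with that s loop_inv show ?thesis by (simp add: loop_inv_def)
  next
    case (Suc k')
    then have "s + 2 ^ Suc k \<le> t + 1 - 2 * 2 ^ Suc k'" using s by simp
    with that have "(i + 1) * 2 ^ Suc k' \<le> t + 1 - 2 * 2 ^ Suc k'"
      unfolding Suc by (rule order_trans)
    moreover have "level_inv A h k' (t + 1 - 2 * 2 ^ Suc k')"
      using loop_inv Suc unfolding loop_inv_def by (metis lessI)
    ultimately show ?thesis unfolding level_inv_def Suc by blast
  qed
  have e: "2 * ?j * 2 ^ k = ?j * 2 ^ Suc k" "(2 * ?j + 1 + 1) * 2 ^ k = (?j + 1) * 2 ^ Suc k" by simp_all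
  have e': "(2 * ?j + 1) * 2 ^ k = ?j * 2 ^ Suc k + 2 ^ k" "(2 * ?j + 1 + 1) * 2 ^ k = ?j * 2 ^ Suc k + 2 ^ Suc k"
    "(2::nat) ^ Suc k = 2 * 2 ^ k" by (simp_all add: algebra_simps)
  have "complete_block A h k (2 * ?j)" "complete_block A h k (2 * ?j + 1)"
    by (rule *, use j e' in linarith)+
  then show ?thesis
    unfolding target_def Let_def complete_block_def e[symmetric]
    using inserted_merge[where d = 0 and c = 0] by auto
qed

lemma loop_inv_imp_level_pre:
  assumes loop_inv: "loop_inv A t k h" and s: "s + 2 * 2 ^ Suc k = t" and R: "room W t"
  shows "level_pre t k s W h"
proof -
  have "t - 2 * 2 ^ Suc k = s" using s by simp
  then have "level_inv A h k s" using loop_inv unfolding loop_inv_def by (metis less_irrefl)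
  then have "merging h k s (s mod 2 ^ Suc k) (cnt h (Suc k) s) (len h (Suc k) s)"
    by (simp add: level_inv_def)
  moreover define M where "M = target h k s"
  ultimately have c: "cnt h (Suc k) s \<le> s mod 2 ^ Suc k" "cnt h (Suc k) s \<le> 2 ^ k"
    and T: "tails (map snd (take (s mod 2 ^ Suc k) M)) (map (\<lambda>m. vmem h (adr 1 (Suc k) m)) [0..<len h (Suc k) s])"
    unfolding merging_def target_def Let_def by blast+
  \<comment> \<open>There are as many tails as the LIS of the prefix is long, hence at most one per
    entry.\<close>
  have "len h (Suc k) s = LIS (map snd (take (s mod 2 ^ Suc k) M))"
    using tails_length[OF T] by simp
  also have "\<dots> \<le> s mod 2 ^ Suc k"
    by (rule order_trans[OF LIS_le_length]) (simp del: power_Suc)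
  finally have l: "len h (Suc k) s \<le> s mod 2 ^ Suc k" .
  have "vmem h (adr 1 (Suc k) m) < vmem h (adr 1 (Suc k) m')" if "m < m'" "m' < len h (Suc k) s" for m m'
    using T that by (auto simp: tails_def sorted_wrt_iff_nth_less)
  then show ?thesis
    using R s loop_inv c l unfolding level_pre_def loop_inv_def by blast
qed

text \<open>Level \<open>Suc k\<close> gains entry \<open>s\<close>, so \<open>level_inv\<close> for
  \<open>k\<close> moves on to \<open>Suc s\<close>. All other levels follow from
  \<open>level_inv_frame\<close>.\<close>

lemma loop_inv_step:
  assumes loop_inv: "loop_inv A t k h" and s: "s + 2 * 2 ^ Suc k = t" and post: "level_post k s h h'"
  shows "loop_inv A t (Suc k) h'"
proof -
  define j r where "j = s div 2 ^ Suc k" "r = s mod 2 ^ Suc k"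
  note defs = this
  define M where "M = target h k s"
  have sjr: "s = j * 2 ^ Suc k + r" and r: "r < 2 ^ Suc k"
    unfolding defs by (rule mod_div_bounds)+
  have "t - 2 * 2 ^ Suc k = s" using s by simp
  then have lev: "level_inv A h k s" using loop_inv unfolding loop_inv_def by (metis less_irrefl)
  then have m: "merging h k s (s mod 2 ^ Suc k) (cnt h (Suc k) s) (len h (Suc k) s)"
    by (simp add: level_inv_def)
  note st = merging_step[OF m post, folded defs, folded M_def]
  have M: "inserted 0 M (A (j * 2 ^ Suc k)) (A ((j + 1) * 2 ^ Suc k))"
    unfolding M_def defs by (rule loop_inv_target[OF loop_inv s])
  have lenM: "length M = 2 ^ Suc k" by (simp add: M_def)
  have hist: "A 0 = []" "\<And>m. m \<le> t + 1 \<Longrightarrow> length (A m) = m"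
    "\<And>m m'. m \<le> t + 1 \<Longrightarrow> m' \<le> m \<Longrightarrow> subseq (A m') (A m)"
    using loop_inv by (auto simp: loop_inv_def history_def)
  have jt: "(j + 1) * 2 ^ Suc k \<le> t" using s sjr by (simp add: algebra_simps)
  define l c where "l = wmem h' (adr 2 (Suc k) 0)" "c = wmem h' (adr 1 (Suc k) 0)"
  note l_def = this(1) and c_def = this(2)
  have T: "tails (map snd (take (Suc r) M)) (map (\<lambda>m. vmem h' (adr 1 (Suc k) m)) [0..<l])"
    and E: "map (entry h' (Suc k)) [j * 2 ^ Suc k..<j * 2 ^ Suc k + Suc r] = take (Suc r) M"
    and C: "c \<le> 2 ^ k"
    using st(1) unfolding merging_def Let_def defs(1)[symmetric] l_def c_def
      st(2)[unfolded target_def Let_def defs(1)[symmetric]] by blast+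
  have l: "l = LIS (map snd (take (Suc r) M))"
    using tails_length[OF T] by simp
  \<comment> \<open>A prefix of a block is a subsequence of the block, hence of the array at its end
    and, by \<open>history\<close>, of the current array. So the reported value never exceeds the
    true LIS.\<close>
  have lM: "l \<le> LIS (map snd M)"
    unfolding l by (intro LIS_mono) (metis prefix_imp_subseq take_is_prefix take_map)
  also have "\<dots> \<le> LIS (A (t + 1))"
    using inserted_subseq[OF M] hist(3)[of "t + 1" "(j + 1) * 2 ^ Suc k"] jt
    by (intro LIS_mono) (meson le_add1 order_refl subseq_order.order_trans order_trans)
  finally have l_le: "l \<le> LIS (A (t + 1))" .
  have lenA: "LIS (A (t + 1)) \<le> t + 1"
    using LIS_le_length[of "A (t + 1)"] hist(2)[of "t + 1"] by simp
  have best: "wmem h' 1 = max (wmem h 1) l" unfolding l_def by (rule st(3))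
  from post obtain lo where
      wm: "wmem h' = (wmem h)(adr 0 (Suc k) s := fst (next_entry h k s),
           adr 1 (Suc k) 0 := c,
           adr 2 (Suc k) 0 := l, 1 := max (wmem h 1) l)"
    and vm: "vmem h' = (vmem h)(adr 0 (Suc k) s := snd (next_entry h k s), adr 1 (Suc k) lo := snd (next_entry h k s))"
    unfolding level_post_def Let_def l_def c_def by (force simp: adr_eq_iff)
  \<comment> \<open>Positions in a block refer to the array at its end, which has at most
    \<open>t\<close> elements.\<close>
  have "fst (next_entry h k s) \<le> t"
  proof -
    have "next_entry h k s \<in> set M" using st(4) r lenM by simp
    from inserted_pos[OF M this] hist(2)[of "(j + 1) * 2 ^ Suc k"] jt show ?thesis by simp
  qed
  moreover have "c \<le> t" using C s by simp
  ultimately have bound: "wmem h' a \<le> t + 1" for a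
    unfolding wm using best l_le lenA loop_inv by (auto simp: loop_inv_def)
  have bestA: "wmem h' 1 \<le> LIS (A (t + 1))"
    using best l_le loop_inv by (auto simp: loop_inv_def)
  have frame: "entry h' k' s' = entry h k' s'" if "k' \<noteq> Suc k \<or> s' \<noteq> s" for k' s'
    unfolding entry_def wm vm using that by (auto simp: adr_eq_iff)
  have frame_w: "wmem h' (adr i k' 0) = wmem h (adr i k' 0)" if "k' \<noteq> Suc k" "i \<in> {1, 2}" for i k'
    unfolding wm using that by (auto simp: adr_eq_iff)
  have frame_v: "vmem h' (adr 1 k' m) = vmem h (adr 1 k' m)" if "k' \<noteq> Suc k" for k' m
    unfolding vm using that by (auto simp: adr_eq_iff)
  have best_mono: "wmem h 1 \<le> wmem h' 1" unfolding best by simp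
  have 0: "complete_block A h' 0 i" if "i \<le> t" for i
  proof (rule complete_mono)
    show "complete_block A h 0 i" using loop_inv that by (simp add: loop_inv_def)
  qed (auto simp: frame best_mono simp del: One_nat_def)
  have old: "complete_block A h' (Suc k) i" if i: "(i + 1) * 2 ^ Suc k \<le> s" for i
  proof (rule complete_mono)
    show "complete_block A h (Suc k) i" using lev i unfolding level_inv_def by blast
    show "entry h' (Suc k) s' = entry h (Suc k) s'" if "s' < (i + 1) * 2 ^ Suc k" for s'
      using that i by (intro frame) auto
  qed (simp_all add: best_mono del: One_nat_def)
  \<comment> \<open>Either entry \<open>s\<close> closes block \<open>j\<close>, whose LIS is then
    accounted for in word 1, or the same merge continues.\<close>
  have new: "level_inv A h' k (Suc s)"
  proof (cases "Suc r = 2 ^ Suc k")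
    case True
    have S: "Suc s = (j + 1) * 2 ^ Suc k" using sjr True by simp
    have "(j + 1) * 2 ^ Suc k = j * 2 ^ Suc k + Suc r" "take (Suc r) M = M"
      using True lenM by simp_all
    then have "block h' (Suc k) j = M"
      using E unfolding block_def by (simp only:)
    then have "complete_block A h' (Suc k) j"
      using M lM l True lenM best by (simp add: complete_block_def)
    moreover have "(i + 1) * 2 ^ Suc k \<le> s" if "(i + 1) * 2 ^ Suc k \<le> Suc s" "i \<noteq> j" for i
    proof -
      have "i + 1 \<le> j + 1" using that(1) unfolding S by (simp only: mult_le_cancel2) simp
      with that(2) have "i + 1 \<le> j" by simp
      then have "(i + 1) * 2 ^ Suc k \<le> j * 2 ^ Suc k" by (rule mult_le_mono1)
      with sjr show ?thesis by linarith
    qed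
    ultimately have all: "complete_block A h' (Suc k) i" if "(i + 1) * 2 ^ Suc k \<le> Suc s" for i
      using old that by (cases "i = j") blast+
    have "Suc s mod 2 ^ Suc k = 0" unfolding S by (rule mod_mult_self2_is_0)
    then show ?thesis
      unfolding level_inv_def by (intro conjI allI impI all merging_0)
  next
    case False
    then have "Suc r < 2 ^ Suc k" using r by simp
    have S: "Suc s = Suc r + j * 2 ^ Suc k" using sjr by simp
    have S1: "Suc s mod 2 ^ Suc k = Suc r" "Suc s div 2 ^ Suc k = j"
      unfolding S using \<open>Suc r < 2 ^ Suc k\<close> by (simp_all only: mod_mult_self1 mod_less div_mult_self1 div_less)
    have "merging h' k (Suc s) (Suc r) (wmem h' (adr 1 (Suc k) 0)) (wmem h' (adr 2 (Suc k) 0))"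
      using st(1) unfolding merging_def S1 defs(1)[symmetric] .
    then have mer: "merging h' k (Suc s) (Suc s mod 2 ^ Suc k) (cnt h' (Suc k) (Suc s)) (len h' (Suc k) (Suc s))"
      unfolding cnt_def len_def S1(1) by simp
    have le: "(i + 1) * 2 ^ Suc k \<le> s" if "(i + 1) * 2 ^ Suc k \<le> Suc s" for i
    proof (rule ccontr)
      assume "\<not> ?thesis"
      then have "Suc s = (i + 1) * 2 ^ Suc k" using that by simp
      then have "Suc s mod 2 ^ Suc k = 0" by (simp only: mod_mult_self2_is_0)
      with S1 show False by simp
    qed
    show ?thesis
      unfolding level_inv_def using mer by (intro conjI allI impI old le)
  qed
  have "level_inv A h' k' ((if k' < Suc k then t + 1 else t) - 2 * 2 ^ Suc k')" for k'
  proof (cases "k' = k")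
    case True
    have "t + 1 - 2 * 2 ^ Suc k = Suc s" using s by simp
    with True new show ?thesis by simp
  next
    case False
    let ?s = "(if k' < k then t + 1 else t) - 2 * 2 ^ Suc k'"
    have "level_inv A h k' ?s" using loop_inv unfolding loop_inv_def by blast
    then have "level_inv A h' k' ?s"
    proof (rule level_inv_frame)
      fix s' assume "0 < ?s" "s' < ?s + 2 ^ Suc k'"
      \<comment> \<open>The level above reads entries below
        \<open>t - 2 * 2 ^ Suc k' + 2 ^ Suc k'\<close>, and for \<open>k' = Suc k\<close> this bound
        is exactly \<open>s\<close>, the entry just written.\<close>
      have "s' \<noteq> s" if "k' = Suc k"
        using \<open>0 < ?s\<close> \<open>s' < _\<close> s that by simp
      then show "entry h' k' s' = entry h k' s'" by (intro frame) auto
    qed (use False in \<open>auto simp: frame frame_w frame_v best_mono simp del: One_nat_def\<close>)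
    moreover have "k' < Suc k \<longleftrightarrow> k' < k" using False by auto
    ultimately show ?thesis by simp
  qed
  with loop_inv bound bestA 0 show ?thesis unfolding loop_inv_def by blast
qed

section \<open>The invariant between insertions\<close>

definition heap_inv :: "(nat \<Rightarrow> real list) \<Rightarrow> nat \<Rightarrow> heap \<Rightarrow> bool" where
  "heap_inv A n h \<longleftrightarrow> history A n \<and> wmem h 0 = n \<and> (\<forall>a. wmem h a \<le> n) \<and> wmem h 1 \<le> LIS (A n) \<and>
     (\<forall>j<n. complete_block A h 0 j) \<and> (\<forall>k. level_inv A h k (n - 2 * 2 ^ Suc k))"

lemma heap_inv_empty: "heap_inv (\<lambda>_. []) 0 empty_heap"
  by (simp add: heap_inv_def history_def empty_heap_def level_inv_0 del: power_Suc)

lemma length_insert_at: "valid_insert i x a \<Longrightarrow> length (insert_at i x a) = length a + 1"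
  by (auto simp: insert_at_def valid_insert_def min_def)

lemma loop_inv_0:
  assumes inv: "heap_inv A t h" and i: "valid_insert i x (A t)"
    and wm: "wmem h1 = (wmem h)(adr 0 0 t := i, 1 := max 1 (wmem h 1))"
    and vm: "vmem h1 = (vmem h)(adr 0 0 t := x)"
  shows "loop_inv (A(t + 1 := insert_at i x (A t))) t 0 h1"
proof -
  let ?a = "insert_at i x (A t)"
  let ?A = "A(t + 1 := ?a)"
  have len: "length (A t) = t" using inv by (auto simp: heap_inv_def history_def)
  have i': "1 \<le> i" "i - 1 \<le> length (A t)" "i \<le> t + 1" using i len by (auto simp: valid_insert_def)
  have ins: "inserted 0 [(i, x)] (A t) ?a"
    using inserted_single[of "i - 1" "A t" 0 x] i' by (simp add: insert_at_def)
  have sub: "subseq (A t) ?a"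
  proof -
    have "subseq (take (i - 1) (A t) @ drop (i - 1) (A t)) ?a"
      unfolding insert_at_def by (intro list_emb_append_mono) (auto intro: list_emb_Cons)
    then show ?thesis by simp
  qed
  have len': "length ?a = t + 1" using length_insert_at[OF i] len by simp
  have hist: "history ?A (t + 1)"
    using inv len' sub unfolding heap_inv_def history_def
    by (auto simp: le_Suc_eq intro: subseq_order.order_trans)
  have ne: "1 \<le> LIS ?a"
    using LIS_mono[OF inserted_subseq[OF ins]] by simp
  have best: "wmem h1 1 = max 1 (wmem h 1)" unfolding wm by simp
  have "LIS (A t) \<le> LIS ?a" by (rule LIS_mono[OF sub])
  then have bestA: "wmem h1 1 \<le> LIS (?A (t + 1))"
    using ne inv best by (auto simp: heap_inv_def)
  have "wmem h a \<le> t" for a using inv by (simp add: heap_inv_def)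
  then have bound: "wmem h1 a \<le> t + 1" for a
    unfolding wm using i'(3) by (auto intro: le_SucI)
  have frame: "entry h1 k s = entry h k s" if "k \<noteq> 0 \<or> s \<noteq> t" for k s
    unfolding entry_def wm vm using that by (auto simp: adr_eq_iff)
  have e: "entry h1 0 t = (i, x)"
    unfolding entry_def wm vm by simp
  have best_mono: "wmem h 1 \<le> wmem h1 1" unfolding best by simp
  have 0: "complete_block ?A h1 0 j" if "j \<le> t" for j
  proof (cases "j = t")
    case True
    then show ?thesis using ins e best by (simp add: complete_block_def block_def)
  next
    case False
    show ?thesis
    proof (rule complete_mono)
      show "complete_block A h 0 j" using inv that False by (simp add: heap_inv_def)
    qed (use that False in \<open>auto simp: best_mono simp del: One_nat_def intro!: frame\<close>)
  qed
  have "level_inv ?A h1 k (t - 2 * 2 ^ Suc k)" for k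
  proof (rule level_inv_frame)
    show "level_inv A h k (t - 2 * 2 ^ Suc k)" using inv by (simp add: heap_inv_def del: power_Suc)
    fix s' assume "0 < t - 2 * 2 ^ Suc k" "s' < t - 2 * 2 ^ Suc k + 2 ^ Suc k"
    then have "s' \<noteq> t" by simp
    then show "entry h1 k s' = entry h k s'" by (intro frame) simp
  qed (auto simp: best_mono frame wm vm adr_eq_iff simp del: power_Suc)
  then show ?thesis
    unfolding loop_inv_def using hist bound bestA 0 by simp
qed

lemma loop_inv_final:
  assumes loop_inv: "loop_inv A t k h" and t: "t < 2 * 2 ^ Suc k"
    and wm: "wmem h' = (wmem h)(0 := t + 1)" and vm: "vmem h' = vmem h"
  shows "heap_inv A (t + 1) h'"
proof -
  have e: "entry h' k s = entry h k s" for k s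
    unfolding entry_def wm vm by simp
  have b: "wmem h' 1 = wmem h 1" unfolding wm by simp
  have "complete_block A h' 0 j" if "j < t + 1" for j
    by (rule complete_mono[of A h]) (use loop_inv that b in \<open>auto simp: loop_inv_def e simp del: One_nat_def\<close>)
  moreover have "level_inv A h' k' (t + 1 - 2 * 2 ^ Suc k')" for k'
  proof (rule level_inv_frame)
    have "level_inv A h k' ((if k' < k then t + 1 else t) - 2 * 2 ^ Suc k')"
      using loop_inv unfolding loop_inv_def by blast
    \<comment> \<open>Levels that the loop did not reach have not started: both differences truncate
      to 0.\<close>
    moreover have "t + 1 - 2 * 2 ^ Suc k' = 0 \<and> t - 2 * 2 ^ Suc k' = 0" if "\<not> k' < k"
    proof -
      have "(2::nat) ^ Suc k \<le> 2 ^ Suc k'" using that by simp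
      with t show ?thesis by linarith
    qed
    ultimately show "level_inv A h k' (t + 1 - 2 * 2 ^ Suc k')"
      by (cases "k' < k") (simp_all del: power_Suc)
  qed (simp_all add: e vm b del: One_nat_def, simp add: wm)
  ultimately show ?thesis
    using loop_inv unfolding heap_inv_def loop_inv_def b by (simp add: wm)
qed

section \<open>Approximation and running time\<close>

text \<open>\<open>cov k\<close> counts the entries produced on level \<open>k\<close>, and
  \<open>E k\<close> its complete blocks. Going down from level \<open>K\<close>, where nothing is
  complete, to level 0, where everything is, each level adds fewer than six blocks.\<close>

lemma LIS_cover:
  assumes inv: "heap_inv A n h" and K: "n < 2 ^ K"
  shows "LIS (A n) \<le> 6 * K * wmem h 1"
proof -
  define cov where "cov k = n - (if k = 0 then 0 else 2 * 2 ^ k)" for k :: nat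
  define E where "E k = cov k div 2 ^ k" for k
  have complete: "complete_block A h k j" if "(j + 1) * 2 ^ k \<le> cov k" for j k
  proof (cases k)
    case 0
    then show ?thesis using that inv by (simp add: heap_inv_def cov_def)
  next
    case (Suc k')
    then show ?thesis
      using that inv unfolding heap_inv_def level_inv_def cov_def by auto
  qed
  have run: "LIS (A ((j + m) * 2 ^ k)) \<le> LIS (A (j * 2 ^ k)) + m * wmem h 1"
    if "(j + m) * 2 ^ k \<le> cov k" for j m k
    using that
  proof (induction m)
    case (Suc m)
    have "(j + m) * 2 ^ k \<le> (j + Suc m) * 2 ^ k" by (intro mult_le_mono1) simp
    with Suc have IH: "LIS (A ((j + m) * 2 ^ k)) \<le> LIS (A (j * 2 ^ k)) + m * wmem h 1" by simp
    have "complete_block A h k (j + m)" using Suc.prems by (intro complete) simp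
    then have "LIS (A ((j + m + 1) * 2 ^ k)) \<le> LIS (A ((j + m) * 2 ^ k)) + wmem h 1"
      unfolding complete_block_def using inserted_LIS_le by (meson add_left_mono order_trans)
    with IH show ?case by simp
  qed simp
  \<comment> \<open>Six is four plus two: the delays differ by at most \<open>4 * 2 ^ k\<close>,
    attained at \<open>k = 0\<close>, and rounding to blocks of level \<open>Suc k\<close> loses
    less than \<open>2 * 2 ^ k\<close>.\<close>
  have step: "LIS (A (E k * 2 ^ k)) \<le> LIS (A (E (Suc k) * 2 ^ Suc k)) + 6 * wmem h 1" for k
  proof -
    have p: "(2::nat) ^ Suc k = 2 * 2 ^ k" by simp
    have le: "cov (Suc k) \<le> cov k" "cov k \<le> cov (Suc k) + 4 * 2 ^ k"
      by (auto simp: cov_def)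
    have 1: "E (Suc k) * (2 * 2 ^ k) \<le> cov (Suc k)" "cov (Suc k) < (E (Suc k) + 1) * (2 * 2 ^ k)"
      unfolding E_def p[symmetric] by (rule mod_div_bounds)+
    have 2: "E k * 2 ^ k \<le> cov k" "cov k < (E k + 1) * 2 ^ k"
      unfolding E_def by (rule mod_div_bounds)+
    have "(2 * E (Suc k)) * 2 ^ k < (E k + 1) * 2 ^ k" using 1 2 le by simp
    then have a: "2 * E (Suc k) \<le> E k" by (simp only: mult_less_cancel2) simp
    have "E k * 2 ^ k < (2 * E (Suc k) + 6) * 2 ^ k" using 1 2 le by (simp add: algebra_simps)
    then have b: "E k < 2 * E (Suc k) + 6" by (simp only: mult_less_cancel2)
    obtain m where m: "E k = 2 * E (Suc k) + m" using a le_Suc_ex by blast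
    have "LIS (A (E k * 2 ^ k)) \<le> LIS (A (2 * E (Suc k) * 2 ^ k)) + m * wmem h 1"
      using run[of "2 * E (Suc k)" m k] 2(1) unfolding m by simp
    also have "\<dots> \<le> LIS (A (E (Suc k) * 2 ^ Suc k)) + 6 * wmem h 1"
      using b m by (simp add: algebra_simps)
    finally show ?thesis .
  qed
  have "E K = 0" using K by (simp add: E_def cov_def)
  \<comment> \<open>\<open>d\<close> counts levels from the top, where the array is empty.\<close>
  have "LIS (A (E (K - d) * 2 ^ (K - d))) \<le> 6 * d * wmem h 1" if "d \<le> K" for d
    using that
  proof (induction d)
    case 0
    then show ?case using \<open>E K = 0\<close> inv by (simp add: heap_inv_def history_def)
  next
    case (Suc d)
    then have "Suc (K - Suc d) = K - d" by simp
    with step[of "K - Suc d"] Suc show ?case by (simp add: add_mult_distrib)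
  qed
  from this[of K] show ?thesis by (simp add: E_def cov_def)
qed

section \<open>Word length and correctness of an insertion\<close>

definition bits :: "nat \<Rightarrow> nat" where
  "bits n = floorlog 2 n"

lemma less_bits: "n < 2 ^ bits n"
  using floorlog_leD[of 2 n "bits n"] by (simp add: bits_def)

lemma update_correct:
  assumes inv: "heap_inv A t h" and i: "valid_insert i x (A t)" and n: "n = t + 1"
  shows "\<exists>k v h'. update (2 ^ (10 + 2 * bits n)) [insert_procedure] i x h k v h' \<and>
    k \<le> 2000 * (bits n + 1) ^ 2 \<and> heap_inv (A(n := insert_at i x (A t))) n h' \<and>
    LIS (insert_at i x (A t)) \<le> 6 * bits n * v \<and> v \<le> LIS (insert_at i x (A t))"
proof -
  let ?W = "2 ^ (10 + 2 * bits n) :: nat" and ?a = "insert_at i x (A t)"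
  let ?A = "A(n := ?a)"
  let ?f = "args_frame [i] [x]"
  \<comment> \<open>\<open>room\<close> needs 16 times this square, hence at most
    \<open>64 * (2 ^ bits n) ^ 2\<close>, and \<open>?W\<close> has the factor 1024.\<close>
  have "(t + 2) ^ 2 \<le> (2 * 2 ^ bits n) ^ 2"
    using less_bits[of n] n by (intro power_mono) auto
  moreover have "?W = 1024 * (2 ^ bits n) ^ 2"
    by (simp add: power_add power_even_eq)
  ultimately have R: "room ?W t" by (simp add: room_def power_mult_distrib)
  have len: "length (A t) = t" and h: "wmem h 0 = t" "\<And>a. wmem h a \<le> t + 1"
    using inv by (auto simp: heap_inv_def history_def le_SucI)
  have it: "i \<le> t + 1" using i len by (simp add: valid_insert_def)
  have "wp ?W [insert_procedure] insert_procedure (\<lambda>m f' h'. m \<le> 2000 * (bits n + 1) ^ 2 \<and>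
    (\<exists>k h2. loop_inv ?A t k h2 \<and> t < 2 * 2 ^ Suc k \<and> wmem h' = (wmem h2)(0 := t + 1) \<and> vmem h' = vmem h2 \<and>
       wreg f' 0 = wmem h2 1)) ?f h"
  proof (rule insert_procedure_spec[OF R h])
    show "wreg ?f 0 \<le> t + 1" using it by (simp add: args_frame_def)
    show "t < 2 ^ bits n" using less_bits[of n] n by simp
    fix h1 :: heap
    assume "wmem h1 = (wmem h)(adr 0 0 t := wreg ?f 0, 1 := max 1 (wmem h 1))"
      "vmem h1 = (vmem h)(adr 0 0 t := vreg ?f 0)"
    then show "loop_inv ?A t 0 h1"
      unfolding n using loop_inv_0[OF inv i] by (simp add: args_frame_def)
  next
    fix k h and a :: nat assume "loop_inv ?A t k h"
    then show "wmem h a \<le> t + 1" by (simp add: loop_inv_def)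
  next
    fix k s h assume "loop_inv ?A t k h" "s + 2 * 2 ^ Suc k = t"
    then show "level_pre t k s ?W h" using loop_inv_imp_level_pre R by blast
  next
    fix k s h h' assume "loop_inv ?A t k h" "s + 2 * 2 ^ Suc k = t" "level_post k s h h'"
    then show "loop_inv ?A t (Suc k) h'" by (rule loop_inv_step)
  qed
  then obtain m f' h' k h2 where ex: "exec ?W [insert_procedure] insert_procedure ?f h m f' h'"
    and m: "m \<le> 2000 * (bits n + 1) ^ 2"
    and k: "loop_inv ?A t k h2" "t < 2 * 2 ^ Suc k" "wmem h' = (wmem h2)(0 := t + 1)" "vmem h' = vmem h2"
      "wreg f' 0 = wmem h2 1"
    unfolding wp_def by blast
  have inv': "heap_inv ?A n h'"
    unfolding n using loop_inv_final[OF k(1-4)] n by simp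
  have v: "wreg f' 0 = wmem h' 1" using k by simp
  have "wmem h' 1 \<le> t + 1" using inv' n by (simp add: heap_inv_def)
  then have "update ?W [insert_procedure] i x h m (wreg f' 0) h'"
    unfolding update_def using ex v room_less[OF R, of i] room_less[OF R, of "wreg f' 0"] it by auto
  moreover have "LIS ?a \<le> 6 * bits n * wreg f' 0"
    using LIS_cover[OF inv' less_bits] v by simp
  moreover have "wreg f' 0 \<le> LIS ?a"
    using inv' v by (simp add: heap_inv_def)
  ultimately show ?thesis using m inv' by blast
qed

text \<open>\<open>update_correct\<close> yields some run, which by
  \<open>exec_deterministic\<close> is the one behind \<open>reachable\<close>.
  \<open>heap_inv\<close> does not mention the word length, so it survives the change of that length
  from one operation to the next.\<close>

lemma reachable_inv:
  assumes "reachable (\<lambda>n. 10 + 2 * bits n) [insert_procedure] a h"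
  shows "\<exists>A. heap_inv A (length a) h \<and> A (length a) = a"
  using assms
proof (induction rule: reachable.induct)
  case empty
  show ?case using heap_inv_empty by auto
next
  case (insertion a h i x k v h')
  then obtain A where A: "heap_inv A (length a) h" "A (length a) = a" by blast
  let ?n = "length a + 1" and ?a = "insert_at i x a"
  obtain k' v' h'' where u: "update (2 ^ (10 + 2 * bits ?n)) [insert_procedure] i x h k' v' h''"
    "heap_inv (A(?n := ?a)) ?n h''"
    using update_correct[OF A(1) _ refl, of i x] insertion.hyps(2) A(2) by auto
  have "h'' = h'"
    using u(1) insertion.hyps(3) exec_deterministic unfolding update_def by blast
  moreover have "length ?a = ?n"
    using insertion.hyps(2) by (rule length_insert_at)
  ultimately show ?case using u(2) by (intro exI[of _ "A(?n := ?a)"]) (simp del: fun_upd_apply add: fun_upd_same)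
qed

section \<open>Asymptotic bounds and the theorem\<close>

lemma one_le_ln: "3 \<le> n \<Longrightarrow> 1 \<le> ln (real n)"
  using exp_le by (subst ln_ge_iff) auto

lemma const_bigo_ln: "(\<lambda>n. c :: real) \<in> O(\<lambda>n. ln (real n))"
proof (rule bigoI)
  show "\<forall>\<^sub>F n in sequentially. norm c \<le> \<bar>c\<bar> * norm (ln (real n))"
    using eventually_ge_at_top[of 3]
  proof eventually_elim
    case (elim n)
    then show ?case using one_le_ln[OF elim] mult_left_mono[of 1 "ln (real n)" "\<bar>c\<bar>"] by simp
  qed
qed

lemma bits_bigo: "(\<lambda>n. real (bits n)) \<in> O(\<lambda>n. ln (real n))"
proof (rule bigoI)
  show "\<forall>\<^sub>F n in sequentially. norm (real (bits n)) \<le> (1 / ln 2 + 1) * norm (ln (real n))"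
    using eventually_ge_at_top[of 3]
  proof eventually_elim
    case (elim n)
    have "real (bits n) \<le> log 2 n + 1"
      using elim by (simp add: bits_def floorlog_def)
    also have "\<dots> \<le> (1 / ln 2 + 1) * ln (real n)"
      using one_le_ln[OF elim] by (simp add: log_def algebra_simps)
    finally show ?case using one_le_ln[OF elim] by simp
  qed
qed

theorem theorem6:
  shows "\<exists>(P :: program) (b :: nat \<Rightarrow> nat) (T :: nat \<Rightarrow> real) (\<alpha> :: nat \<Rightarrow> real).
           (\<lambda>n. real (b n)) \<in> O(\<lambda>n. ln (real n)) \<and>
           T \<in> O(\<lambda>n. ln (real n) ^ 3) \<and>
           \<alpha> \<in> O(\<lambda>n. ln (real n)) \<and>
           solves_dynamic_LIS_plus b P T \<alpha>"
proof (intro exI conjI)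
  let ?b = "\<lambda>n. 10 + 2 * bits n"
  \<comment> \<open>The \<open>+ 1\<close> in \<open>?\<alpha>\<close> makes it at least 1 even for
    \<open>n = 0\<close>, where \<open>bits\<close> vanishes.\<close>
  let ?T = "\<lambda>n. 2000 * (real (bits n) + 1) ^ 3" and ?\<alpha> = "\<lambda>n. 6 * real (bits n) + 1"
  note bits_bigo [simp] const_bigo_ln [simp]
  show "(\<lambda>n. real (?b n)) \<in> O(\<lambda>n. ln (real n))"
    by (simp add: sum_in_bigo)
  show "?T \<in> O(\<lambda>n. ln (real n) ^ 3)"
    by (simp add: landau_o.big_power sum_in_bigo)
  show "?\<alpha> \<in> O(\<lambda>n. ln (real n))"
    by (simp add: sum_in_bigo)
  show "solves_dynamic_LIS_plus ?b [insert_procedure] ?T ?\<alpha>"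
    unfolding solves_dynamic_LIS_plus_def Let_def
  proof (intro conjI allI impI)
    fix a h i x
    assume "reachable ?b [insert_procedure] a h" and i: "valid_insert i x a"
    then obtain A where A: "heap_inv A (length a) h" "A (length a) = a"
      using reachable_inv by blast
    let ?n = "length a + 1" and ?a = "insert_at i x a"
    have len: "length ?a = ?n"
      using i by (rule length_insert_at)
    obtain k v h' where u: "update (2 ^ ?b ?n) [insert_procedure] i x h k v h'"
      "k \<le> 2000 * (bits ?n + 1) ^ 2" "LIS ?a \<le> 6 * bits ?n * v" "v \<le> LIS ?a"
      using update_correct[OF A(1) _ refl, of i x] i A(2) by auto
    \<comment> \<open>The running time is quadratic in \<open>bits ?n + 1\<close>, and the cube
      weakens this to the claimed bound.\<close>
    have "k \<le> 2000 * (bits ?n + 1) ^ 3"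
      using u(2) by (rule order_trans) (intro mult_le_mono2 power_increasing; simp)
    then have "real k \<le> real (2000 * (bits ?n + 1) ^ 3)" by (simp only: of_nat_le_iff)
    then have k: "real k \<le> ?T ?n" by (simp add: add.commute)
    have "real (LIS ?a) \<le> real (6 * bits ?n * v)" using u(3) by (simp only: of_nat_le_iff)
    also have "\<dots> \<le> real v * ?\<alpha> ?n" by (simp add: algebra_simps)
    finally have "real (LIS ?a) / ?\<alpha> ?n \<le> real v" by (subst pos_divide_le_eq) simp_all
    with u k len show "\<exists>k v h'. update (2 ^ ?b (length ?a)) [insert_procedure] i x h k v h' \<and>
             real k \<le> ?T (length ?a) \<and> real (LIS ?a) / ?\<alpha> (length ?a) \<le> real v \<and> v \<le> LIS ?a"
      by metis
  qed simp
qed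

end
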